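(* Let $\Gamma=(G,\ell)$ be a metric graph of genus $g\geq 2$ whose edge lengths are all rational, i.e. $\ell(e)\in\mathbb{Q}_{>0}$ for all $e\in E(G)$. Then $\Gamma$ does not satisfy the Manin--Mumford condition.
   Context: A metric graph $\Gamma=(G,\ell)$ is the compact connected metric space obtained from a finite connected graph $G$ (loops and multiple edges allowed) with edge lengths $\ell:E(G)\to\mathbb{R}_{>0}$ by identifying each edge $e$ with a closed interval $[0,\ell(e)]$ and taking the path metric; $(G,\ell)$ is then called a model of $\Gamma$ (a metric graph has many models). The genus of $\Gamma$ is $g=\dim H_1(\Gamma,\mathbb{R})=\#E(G)-\#V(G)+1$. $\mathrm{Div}(\Gamma)$ is the free abelian group on the points of $\Gamma$, $\deg$ is the sum of coefficients, and $\mathrm{Div}^0(\Gamma)=\ker(\deg)$. $\mathrm{PL}_{\mathbb{Z}}(\Gamma)$ is the set of continuous functions $f:\Gamma\to\mathbb{R}$ that are linear with integer slope (with respect to arc length) on each edge of some model of $\Gamma$. For such $f$, $\Delta(f)=-\sum_{x\in\Gamma}a_x\,x$, where $a_x$ is the sum of the outgoing slopes of $f$ at $x$. The Jacobian is $\mathrm{Jac}(\Gamma)=\mathrm{Div}^0(\Gamma)/\Delta(\mathrm{PL}_{\mathbb{Z}}(\Gamma))$, and $\mathrm{Jac}(\Gamma)_{\mathrm{tors}}$ is its torsion subgroup. The Abel--Jacobi map with basepoint $q\in\Gamma$ is $\iota_q:\Gamma\to\mathrm{Jac}(\Gamma)$, $\iota_q(x)=[x-q]$. $\Gamma$ satisfies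 the Manin--Mumford condition if $\iota_q(\Gamma)\cap\mathrm{Jac}(\Gamma)_{\mathrm{tors}}$ is finite for every $q\in\Gamma$. *)

theory Defs
  imports
    "HOL-Analysis.Analysis"
    "HOL-Algebra.Algebra"
    "Graph_Theory.Graph_Theory"
begin

section \<open>Metric graphs\<close>

text \<open>
  A finite multigraph is a finite directed multigraph: the arcs are the edges, and the orientation
  only serves to parametrise the edge \<open>e\<close> by \<open>[0, len e]\<close>, from \<open>tail G e\<close> to \<open>head G e\<close>.
  Loops and parallel arcs are allowed; the library's notion of connectedness ignores
  the orientation and includes that there is at least one vertex.
\<close>

locale metric_graph = fin_digraph G for G :: "('v, 'e) pre_digraph" and len :: "'e \<Rightarrow> real" +
  assumes connected: "Digraph_Component.connected G"
    and len_pos: "e \<in> arcs G \<Longrightarrow> 0 < len e"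

definition genus :: "('v, 'e) pre_digraph \<Rightarrow> int" where
  "genus G = int (card (arcs G)) - int (card (verts G)) + 1"

text \<open>
  The quotient of the disjoint union of the edges \<open>[0, len e]\<close> that glues the end points at
  the vertices is represented by normal forms: \<open>edge_pt G len e t\<close> is the image of \<open>t \<in> [0, len e]\<close>.
\<close>

datatype ('v, 'e) point = Vertex 'v | Interior 'e real

definition edge_pt :: "('v, 'e) pre_digraph \<Rightarrow> ('e \<Rightarrow> real) \<Rightarrow> 'e \<Rightarrow> real \<Rightarrow> ('v, 'e) point" where
  "edge_pt G len e t =
     (if t \<le> 0 then Vertex (tail G e) else if len e \<le> t then Vertex (head G e) else Interior e t)"

definition points :: "('v, 'e) pre_digraph \<Rightarrow> ('e \<Rightarrow> real) \<Rightarrow> ('v, 'e) point set" where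
  "points G len = Vertex ` verts G \<union> {edge_pt G len e t |e t. e \<in> arcs G \<and> 0 \<le> t \<and> t \<le> len e}"

text \<open>
  \<open>broken_path G len x y r\<close>: there is a path of length \<open>r\<close> from \<open>x\<close> to \<open>y\<close> that is a
  concatenation of finitely many segments, each of which runs inside one closed edge.
\<close>

inductive broken_path ::
    "('v, 'e) pre_digraph \<Rightarrow> ('e \<Rightarrow> real) \<Rightarrow> ('v, 'e) point \<Rightarrow> ('v, 'e) point \<Rightarrow> real \<Rightarrow> bool"
  for G len where
  start: "x \<in> points G len \<Longrightarrow> broken_path G len x x 0"
| step: "\<lbrakk>broken_path G len x (edge_pt G len e s) r; e \<in> arcs G;
          0 \<le> s; s \<le> len e; 0 \<le> t; t \<le> len e\<rbrakk>
         \<Longrightarrow> broken_path G len x (edge_pt G len e t) (r + \<bar>t - s\<bar>)"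

definition path_dist ::
    "('v, 'e) pre_digraph \<Rightarrow> ('e \<Rightarrow> real) \<Rightarrow> ('v, 'e) point \<Rightarrow> ('v, 'e) point \<Rightarrow> real" where
  "path_dist G len x y = (if x \<in> points G len \<and> y \<in> points G len
     then Inf {r. broken_path G len x y r} else 0)"

abbreviation graph_topology :: "('v, 'e) pre_digraph \<Rightarrow> ('e \<Rightarrow> real) \<Rightarrow> ('v, 'e) point topology" where
  "graph_topology G len \<equiv> Metric_space.mtopology (points G len) (path_dist G len)"

text \<open>
  \<open>(H, len')\<close> is a model of the metric space \<open>(M, d)\<close>, by means of the isometry \<open>\<phi>\<close>.
\<close>

definition is_model ::
    "'a set \<Rightarrow> ('a \<Rightarrow> 'a \<Rightarrow> real) \<Rightarrow> ('v, 'e) pre_digraph \<Rightarrow> ('e \<Rightarrow> real) \<Rightarrow> (('v, 'e) point \<Rightarrow> 'a) \<Rightarrow> bool" where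
  "is_model M d H len' \<phi> \<longleftrightarrow> metric_graph H len' \<and> bij_betw \<phi> (points H len') M \<and>
     (\<forall>x \<in> points H len'. \<forall>y \<in> points H len'. d (\<phi> x) (\<phi> y) = path_dist H len' x y)"


section \<open>Piecewise linear functions and their divisors\<close>

text \<open>
  Models range over graphs whose vertices and edges are natural numbers. As graphs are finite, this
  covers every model up to renaming, also if \<open>'v\<close> or \<open>'e\<close> is too small a type for subdivisions.
\<close>

definition PL_Z :: "('v, 'e) pre_digraph \<Rightarrow> ('e \<Rightarrow> real) \<Rightarrow> (('v, 'e) point \<Rightarrow> real) set" where
  "PL_Z G len = {f. continuous_map (graph_topology G len) euclideanreal f \<and>
     (\<exists>(H :: (nat, nat) pre_digraph) len' \<phi>. is_model (points G len) (path_dist G len) H len' \<phi> \<and>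
        (\<forall>e \<in> arcs H. \<exists>(a :: int) (b :: real). \<forall>t. 0 \<le> t \<and> t \<le> len' e \<longrightarrow>
           f (\<phi> (edge_pt H len' e t)) = of_int a * t + b))}"

text \<open>
  A direction at \<open>x\<close> is a triple \<open>(e, t, s)\<close> such that one can leave \<open>x\<close>, located at parameter \<open>t\<close> of
  the edge \<open>e\<close>, along \<open>e\<close> with increasing (\<open>s = 1\<close>) or decreasing (\<open>s = -1\<close>) parameter.
  There are two at an interior point of an edge; a loop contributes two at its vertex.
\<close>

definition directions :: "('v, 'e) pre_digraph \<Rightarrow> ('e \<Rightarrow> real) \<Rightarrow> ('v, 'e) point \<Rightarrow> ('e \<times> real \<times> real) set" where
  "directions G len x = {(e, t, s). e \<in> arcs G \<and> 0 \<le> t \<and> t \<le> len e \<and> edge_pt G len e t = x \<and>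
     (s = 1 \<and> t < len e \<or> s = -1 \<and> 0 < t)}"

definition outgoing_slope ::
    "('v, 'e) pre_digraph \<Rightarrow> ('e \<Rightarrow> real) \<Rightarrow> (('v, 'e) point \<Rightarrow> real) \<Rightarrow> 'e \<times> real \<times> real \<Rightarrow> real" where
  "outgoing_slope G len f = (\<lambda>(e, t, s). Lim (at_right 0)
     (\<lambda>h. (f (edge_pt G len e (t + s * h)) - f (edge_pt G len e t)) / h))"

text \<open>
  Divisors are elements of the free abelian group on the points. For \<open>f\<close> in \<^const>\<open>PL_Z\<close> the sum
  below is an integer and nonzero at finitely many points only; the floor is just the conversion.
\<close>

definition laplacian ::
    "('v, 'e) pre_digraph \<Rightarrow> ('e \<Rightarrow> real) \<Rightarrow> (('v, 'e) point \<Rightarrow> real) \<Rightarrow> ('v, 'e) point \<Rightarrow>\<^sub>0 int" where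
  "laplacian G len f =
     Abs_poly_mapping (\<lambda>x. - \<lfloor>\<Sum>\<delta> \<in> directions G len x. outgoing_slope G len f \<delta>\<rfloor>)"


section \<open>The Jacobian and the Manin--Mumford condition\<close>

definition deg :: "('a \<Rightarrow>\<^sub>0 int) \<Rightarrow> int" where
  "deg D = (\<Sum>x \<in> Poly_Mapping.keys D. Poly_Mapping.lookup D x)"

definition Div :: "('v, 'e) pre_digraph \<Rightarrow> ('e \<Rightarrow> real) \<Rightarrow> (('v, 'e) point \<Rightarrow>\<^sub>0 int) monoid" where
  "Div G len = free_Abelian_group (points G len)"

definition Div0 :: "('v, 'e) pre_digraph \<Rightarrow> ('e \<Rightarrow> real) \<Rightarrow> (('v, 'e) point \<Rightarrow>\<^sub>0 int) monoid" where
  "Div0 G len = (Div G len)\<lparr>carrier := {D \<in> carrier (Div G len). deg D = 0}\<rparr>"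

definition principal_divisors :: "('v, 'e) pre_digraph \<Rightarrow> ('e \<Rightarrow> real) \<Rightarrow> (('v, 'e) point \<Rightarrow>\<^sub>0 int) set" where
  "principal_divisors G len = laplacian G len ` PL_Z G len"

definition Jac :: "('v, 'e) pre_digraph \<Rightarrow> ('e \<Rightarrow> real) \<Rightarrow> (('v, 'e) point \<Rightarrow>\<^sub>0 int) set monoid" where
  "Jac G len = Div0 G len Mod principal_divisors G len"

definition torsion :: "('a, 'b) monoid_scheme \<Rightarrow> 'a set" where
  "torsion A = {x \<in> carrier A. \<exists>n :: nat. 0 < n \<and> x [^]\<^bsub>A\<^esub> n = \<one>\<^bsub>A\<^esub>}"

definition abel_jacobi ::
    "('v, 'e) pre_digraph \<Rightarrow> ('e \<Rightarrow> real) \<Rightarrow> ('v, 'e) point \<Rightarrow> ('v, 'e) point \<Rightarrow> (('v, 'e) point \<Rightarrow>\<^sub>0 int) set" where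
  "abel_jacobi G len q x = principal_divisors G len #>\<^bsub>Div0 G len\<^esub> (frag_of x - frag_of q)"

definition manin_mumford :: "('v, 'e) pre_digraph \<Rightarrow> ('e \<Rightarrow> real) \<Rightarrow> bool" where
  "manin_mumford G len \<longleftrightarrow>
     (\<forall>q \<in> points G len. finite (abel_jacobi G len q ` points G len \<inter> torsion (Jac G len)))"


section \<open>The path metric is a metric\<close>

context metric_graph
begin

lemma edge_pt_in_points:
  "e \<in> arcs G \<Longrightarrow> 0 \<le> t \<Longrightarrow> t \<le> len e \<Longrightarrow> edge_pt G len e t \<in> points G len"
  by (auto simp: points_def)

lemma broken_path_points:
  "broken_path G len x y r \<Longrightarrow> x \<in> points G len \<and> y \<in> points G len"
  by (induction rule: broken_path.induct) (auto simp: edge_pt_in_points)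

lemma broken_path_nonneg: "broken_path G len x y r \<Longrightarrow> 0 \<le> r"
  by (induction rule: broken_path.induct) auto

lemma broken_path_trans:
  assumes "broken_path G len y z r'" "broken_path G len x y r"
  shows "broken_path G len x z (r + r')"
  using assms
proof (induction rule: broken_path.induct)
  case (step y e s r' t)
  then have "broken_path G len x (edge_pt G len e t) ((r + r') + \<bar>t - s\<bar>)"
    by (intro broken_path.step) auto
  then show ?case by (simp add: add.assoc)
qed auto

lemma broken_path_segment:
  assumes "e \<in> arcs G" "0 \<le> s" "s \<le> len e" "0 \<le> t" "t \<le> len e"
  shows "broken_path G len (edge_pt G len e s) (edge_pt G len e t) \<bar>t - s\<bar>"
  using broken_path.step[OF broken_path.start[OF edge_pt_in_points[OF assms(1-3)]] assms] by simp

lemma broken_path_sym: "broken_path G len x y r \<Longrightarrow> broken_path G len y x r"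
proof (induction rule: broken_path.induct)
  case (step x e s r t)
  have "broken_path G len (edge_pt G len e t) (edge_pt G len e s) \<bar>s - t\<bar>"
    using step by (intro broken_path_segment) auto
  from broken_path_trans[OF step.IH this] show ?case
    by (simp add: abs_minus_commute add.commute)
qed (auto intro: broken_path.start)

lemma broken_path_arc:
  assumes "e \<in> arcs G"
  shows "broken_path G len (Vertex (tail G e)) (Vertex (head G e)) (len e)"
  using broken_path_segment[of e 0 "len e"] len_pos[OF assms] assms
  by (simp add: edge_pt_def)

lemma broken_path_vertices:
  assumes "u \<in> verts G" "v \<in> verts G"
  shows "\<exists>r. broken_path G len (Vertex u) (Vertex v) r"
proof -
  have "(u, v) \<in> rtrancl_on (verts G) (parcs (mk_symmetric G))"
    using connected assms
    by (auto simp: Digraph_Component.connected_def strongly_connected_def reachable_def)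
  then show ?thesis
  proof (induction rule: rtrancl_on.induct)
    case (rtrancl_on_refl a)
    then have "Vertex a \<in> points G len" by (simp add: points_def)
    then show ?case by (blast intro: broken_path.start)
  next
    case (rtrancl_on_into_rtrancl_on a b c)
    then obtain r where r: "broken_path G len (Vertex a) (Vertex b) r" by auto
    have "\<exists>r. broken_path G len (Vertex b) (Vertex c) r"
      using rtrancl_on_into_rtrancl_on.hyps broken_path_arc broken_path_sym
      by (fastforce simp: parcs_mk_symmetric)
    with r show ?case using broken_path_trans by blast
  qed
qed

lemma broken_path_to_vertex:
  assumes "x \<in> points G len"
  shows "\<exists>v \<in> verts G. \<exists>r. broken_path G len x (Vertex v) r"
  using assms unfolding points_def
proof
  assume "x \<in> Vertex ` verts G"
  with broken_path.start[OF assms] show ?thesis by blast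
next
  assume "x \<in> {edge_pt G len e t |e t. e \<in> arcs G \<and> 0 \<le> t \<and> t \<le> len e}"
  then obtain e t where e: "x = edge_pt G len e t" "e \<in> arcs G" "0 \<le> t" "t \<le> len e" by auto
  have "broken_path G len x (edge_pt G len e 0) \<bar>0 - t\<bar>"
    unfolding e(1) using e by (intro broken_path_segment) auto
  then show ?thesis using e by (intro bexI[of _ "tail G e"]) (auto simp: edge_pt_def)
qed

lemma broken_path_exists:
  assumes "x \<in> points G len" "y \<in> points G len"
  shows "\<exists>r. broken_path G len x y r"
  using broken_path_to_vertex[OF assms(1)] broken_path_to_vertex[OF assms(2)]
    broken_path_vertices broken_path_sym broken_path_trans by meson

lemma path_dist_le: "broken_path G len x y r \<Longrightarrow> path_dist G len x y \<le> r"
  using broken_path_points broken_path_nonneg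
  by (auto simp: path_dist_def intro!: cInf_lower bdd_belowI[of _ 0])

lemma path_dist_ge:
  assumes "x \<in> points G len" "y \<in> points G len" "\<And>r. broken_path G len x y r \<Longrightarrow> c \<le> r"
  shows "c \<le> path_dist G len x y"
  using assms broken_path_exists[OF assms(1,2)]
  by (auto simp: path_dist_def intro!: cInf_greatest)

lemma path_dist_approx:
  assumes "x \<in> points G len" "y \<in> points G len" "0 < \<epsilon>"
  shows "\<exists>r. broken_path G len x y r \<and> r < path_dist G len x y + \<epsilon>"
proof (rule ccontr)
  assume "\<not> ?thesis"
  then have "path_dist G len x y + \<epsilon> \<le> path_dist G len x y"
    by (intro path_dist_ge) (use assms in force)+
  with assms show False by simp
qed

lemma broken_path_lipschitz:
  assumes "broken_path G len x y r"
    and "\<And>e s t. e \<in> arcs G \<Longrightarrow> 0 \<le> s \<Longrightarrow> s \<le> len e \<Longrightarrow> 0 \<le> t \<Longrightarrow> t \<le> len e \<Longrightarrow>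
       F (edge_pt G len e t) - F (edge_pt G len e s) \<le> \<bar>t - s\<bar>"
  shows "F y - F x \<le> r"
  using assms(1)
proof (induction rule: broken_path.induct)
  case (step x e s r t)
  then show ?case using assms(2)[of e s t] by linarith
qed auto

lemma separating_function:
  assumes "x \<in> points G len"
  obtains F :: "('v, 'e) point \<Rightarrow> real" where "F x = 0" "\<And>y. y \<noteq> x \<Longrightarrow> 0 < F y \<or> y \<notin> points G len"
    "\<And>e s t. e \<in> arcs G \<Longrightarrow> 0 \<le> s \<Longrightarrow> s \<le> len e \<Longrightarrow> 0 \<le> t \<Longrightarrow> t \<le> len e \<Longrightarrow>
       F (edge_pt G len e t) - F (edge_pt G len e s) \<le> \<bar>t - s\<bar>"
proof (cases x)
  case (Interior e0 t0)
  then have t0: "0 < t0" "t0 < len e0"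
    using assms by (auto simp: points_def edge_pt_def split: if_splits)
  define \<epsilon> where "\<epsilon> = min t0 (len e0 - t0)"
  define F where "F y = (case y of Vertex v \<Rightarrow> \<epsilon>
    | Interior e t \<Rightarrow> if e = e0 then min \<epsilon> \<bar>t - t0\<bar> else \<epsilon>)" for y :: "('v, 'e) point"
  have F: "F (edge_pt G len e t) = (if e = e0 then min \<epsilon> \<bar>t - t0\<bar> else \<epsilon>)"
    if "0 \<le> t" "t \<le> len e" for e t
    using that t0 by (auto simp: F_def edge_pt_def \<epsilon>_def min_def)
  show thesis
  proof (rule that[of F])
    show "F x = 0" using Interior t0 by (simp add: F_def \<epsilon>_def)
    show "0 < F y \<or> y \<notin> points G len" if "y \<noteq> x" for y
      using that Interior t0 by (cases y) (auto simp: F_def \<epsilon>_def)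
    show "F (edge_pt G len e t) - F (edge_pt G len e s) \<le> \<bar>t - s\<bar>"
      if "0 \<le> s" "s \<le> len e" "0 \<le> t" "t \<le> len e" for e s t
      using that by (auto simp: F)
  qed
next
  case (Vertex v)
  define \<epsilon> where "\<epsilon> = Min (insert 1 (len ` arcs G)) / 2"
  have \<epsilon>: "0 < \<epsilon>"
    using len_pos by (auto simp: \<epsilon>_def)
  have \<epsilon>2: "2 * \<epsilon> \<le> len e" if "e \<in> arcs G" for e
    using that by (auto simp: \<epsilon>_def intro!: Min_le)
  define F where "F y = (case y of Vertex w \<Rightarrow> if w = v then 0 else \<epsilon>
    | Interior e t \<Rightarrow> min \<epsilon> (min (if tail G e = v then t else \<epsilon>) (if head G e = v then len e - t else \<epsilon>)))"
    for y :: "('v, 'e) point"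
  have F: "F (edge_pt G len e t) =
      min \<epsilon> (min (if tail G e = v then t else \<epsilon>) (if head G e = v then len e - t else \<epsilon>))"
    if "e \<in> arcs G" "0 \<le> t" "t \<le> len e" for e t
    using that \<epsilon> \<epsilon>2[OF that(1)] by (auto simp: F_def edge_pt_def)
  show thesis
  proof (rule that[of F])
    show "F x = 0" using Vertex by (simp add: F_def)
    show "0 < F y \<or> y \<notin> points G len" if "y \<noteq> x" for y
      using that Vertex \<epsilon> by (cases y) (auto simp: F_def points_def edge_pt_def split: if_splits)
    show "F (edge_pt G len e t) - F (edge_pt G len e s) \<le> \<bar>t - s\<bar>"
      if "e \<in> arcs G" "0 \<le> s" "s \<le> len e" "0 \<le> t" "t \<le> len e" for e s t
      using that by (auto simp: F)
  qed
qed

theorem Metric_space_path_dist: "Metric_space (points G len) (path_dist G len)"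
proof
  show "0 \<le> path_dist G len x y" for x y
    by (cases "x \<in> points G len \<and> y \<in> points G len")
      (use path_dist_ge broken_path_nonneg in \<open>auto simp: path_dist_def\<close>)
  show "path_dist G len x y = path_dist G len y x" for x y
    using broken_path_sym by (auto simp: path_dist_def intro!: arg_cong[where f = Inf])
  show "(path_dist G len x y = 0) = (x = y)"
    if xy: "x \<in> points G len" "y \<in> points G len" for x y
  proof
    assume "x = y"
    then have "path_dist G len x y \<le> 0" "0 \<le> path_dist G len x y"
      using path_dist_le[OF broken_path.start] path_dist_ge broken_path_nonneg xy by auto
    then show "path_dist G len x y = 0" by simp
  next
    assume 0: "path_dist G len x y = 0"
    show "x = y"
    proof (rule ccontr)
      assume ne: "x \<noteq> y"
      obtain F where F: "F x = (0 :: real)" "\<And>y. y \<noteq> x \<Longrightarrow> 0 < F y \<or> y \<notin> points G len"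
        "\<And>e s t. e \<in> arcs G \<Longrightarrow> 0 \<le> s \<Longrightarrow> s \<le> len e \<Longrightarrow> 0 \<le> t \<Longrightarrow> t \<le> len e \<Longrightarrow>
           F (edge_pt G len e t) - F (edge_pt G len e s) \<le> \<bar>t - s\<bar>"
        using separating_function[OF xy(1)] by blast
      have "F y - F x \<le> path_dist G len x y"
        using broken_path_lipschitz F(3) by (intro path_dist_ge xy) blast
      then show False using F(1) F(2)[of y] ne xy 0 by auto
    qed
  qed
  show "path_dist G len x z \<le> path_dist G len x y + path_dist G len y z"
    if xyz: "x \<in> points G len" "y \<in> points G len" "z \<in> points G len" for x y z
  proof (rule field_le_epsilon)
    fix \<epsilon> :: real assume "0 < \<epsilon>"
    then obtain r r' where
      "broken_path G len x y r" "r < path_dist G len x y + \<epsilon> / 2"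
      "broken_path G len y z r'" "r' < path_dist G len y z + \<epsilon> / 2"
      using path_dist_approx[of x y "\<epsilon> / 2"] path_dist_approx[of y z "\<epsilon> / 2"] xyz by auto
    then show "path_dist G len x z \<le> path_dist G len x y + path_dist G len y z + \<epsilon>"
      using path_dist_le broken_path_trans by fastforce
  qed
qed

end

end

theory Submission
  imports Defs
begin

text \<open>
  As the genus is positive, there is a nonzero integral cycle \<open>C\<close>, say with \<open>C e0 \<noteq> 0\<close>. Let \<open>q\<close> be the tail of
  \<open>e0\<close>. All rational points of \<open>e0\<close> are torsion with respect to \<open>q\<close>: Kirchhoff's equations for a current
  from \<open>tail e0\<close> to \<open>head e0\<close> have a solution over the integers, and the resulting potential, corrected by
  a bent function on \<open>e0\<close>, has divisor \<open>n (x - q)\<close>. On the other hand, if \<open>x - y = \<Delta>(f)\<close> for \<open>x, y\<close> in \<open>e0\<close>,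
  then pairing \<open>df\<close> with \<open>C\<close> gives \<open>0\<close>, and since \<open>f\<close> has integer slopes this forces \<open>C e0 * d(x, y)\<close> to be a
  multiple of \<open>1 / N\<close>, where \<open>N\<close> is a common denominator of the edge lengths. So the rational points close
  to \<open>q\<close> on \<open>e0\<close> have pairwise distinct classes.

  Models of \<open>\<Gamma>\<close> are only given up to isometry. They are eliminated by showing that the functions in
  \<^const>\<open>PL_Z\<close> are those that have an integer slope in every direction at every point: an isometry
  maps short segments that leave a point to such segments.
\<close>

section \<open>Integer linear systems and flows\<close>

text \<open>In \<open>PL_Z\<close> the model may depend on the function, so adding two such
  functions would already require a common model. The condition \<open>locally_linear\<close> refers
  only to the edges of the given graph: sums and negatives are immediate, and divisors can be read
  off edge by edge. Integrality is used in two opposite ways. For existence, conductances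
  proportional to 1 / \<open>len e\<close> make the current through an edge equal to the slope of a
  suitably scaled potential; rational lengths make these conductances integral up to a common
  factor, and hence the slopes. The bent function has slopes proportional to a and -b with a * t = b
  * (\<open>len e0\<close> - t), which has positive integer solutions because t and
  \<open>len e0\<close> are rational. For separation, a function with divisor x - y has slopes a, a
  - 1, a on the three pieces of \<open>e0\<close>, so its increment along \<open>e0\<close> misses
  an integer multiple of \<open>len e0\<close> by exactly the gap between the two parameters, while
  on the other edges nothing is missed. The cycle annihilates the increments and leaves only this
  defect.\<close>

lemma integer_system_nontrivial_solution:
  fixes A :: "'i \<Rightarrow> 'j \<Rightarrow> int"
  assumes "finite I" "finite J" "card I < card J"
  shows "\<exists>x. (\<exists>j\<in>J. x j \<noteq> 0) \<and> (\<forall>i\<in>I. (\<Sum>j\<in>J. A i j * x j) = 0)"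
  using assms
proof (induction I arbitrary: J A rule: finite_induct)
  case empty
  then have "J \<noteq> {}" by auto
  then show ?case by (intro exI[of _ "\<lambda>_. 1"]) auto
next
  case (insert i I)
  show ?case
  proof (cases "\<forall>j\<in>J. A i j = 0")
    case True
    have "card I < card J" using insert by simp
    from insert.IH[OF insert.prems(1) this, of A] obtain x where
      "\<exists>j\<in>J. x j \<noteq> 0" "\<forall>i\<in>I. (\<Sum>j\<in>J. A i j * x j) = 0" by blast
    then show ?thesis using True by (intro exI[of _ x]) auto
  next
    case False
    then obtain p where p: "p \<in> J" "A i p \<noteq> 0" by auto
    have "card I < card (J - {p})" "finite (J - {p})" using insert p by auto
    \<comment> \<open>Fraction-free elimination: row k is multiplied by the pivot
      \<open>A i p\<close> before a multiple of row i is subtracted, so the coefficients stay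
      integral.\<close>
    from insert.IH[OF this(2,1), of "\<lambda>k j. A i p * A k j - A k p * A i j"] obtain x where
      x: "\<exists>j\<in>J - {p}. x j \<noteq> 0"
      "\<forall>k\<in>I. (\<Sum>j\<in>J - {p}. (A i p * A k j - A k p * A i j) * x j) = 0" by blast
    \<comment> \<open>Back substitution without division: the other coordinates are scaled by the
      pivot, and coordinate p is then forced by equation i.\<close>
    define y where "y j = (if j = p then - (\<Sum>j\<in>J - {p}. A i j * x j) else A i p * x j)" for j
    have y: "(\<Sum>j\<in>J. A k j * y j) =
        (\<Sum>j\<in>J - {p}. (A i p * A k j - A k p * A i j) * x j)" for k
    proof -
      have "(\<Sum>j\<in>J. A k j * y j) = A k p * y p + (\<Sum>j\<in>J - {p}. A k j * y j)"
        using p insert.prems by (simp add: sum.remove)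
      also have "(\<Sum>j\<in>J - {p}. A k j * y j) = (\<Sum>j\<in>J - {p}. A k j * (A i p * x j))"
        by (intro sum.cong) (auto simp: y_def)
      finally show ?thesis
        by (simp add: y_def sum_distrib_left sum_subtractf algebra_simps)
    qed
    have "(\<Sum>j\<in>J. A i j * y j) = 0" unfolding y by (simp add: algebra_simps)
    moreover have "\<exists>j\<in>J. y j \<noteq> 0" using x(1) p by (auto simp: y_def)
    ultimately show ?thesis using x(2) y by (intro exI[of _ y]) auto
  qed
qed

lemma common_denominator:
  fixes r :: "'i \<Rightarrow> real"
  assumes "finite A" "\<And>i. i \<in> A \<Longrightarrow> r i \<in> \<rat>"
  shows "\<exists>N :: int. 0 < N \<and> (\<forall>i\<in>A. of_int N * r i \<in> \<int>)"
  using assms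
proof (induction A rule: finite_induct)
  case empty
  then show ?case by (intro exI[of _ 1]) simp
next
  case (insert i A)
  obtain N :: int where N: "0 < N" "\<And>i. i \<in> A \<Longrightarrow> of_int N * r i \<in> \<int>"
    using insert.IH insert.prems by auto
  have "r i \<in> \<rat>" using insert.prems by simp
  then obtain a b :: int where ab: "0 < b" "r i = of_int a / of_int b"
    by (rule Rats_cases') auto
  have "of_int (N * b) * r j \<in> \<int>" if "j \<in> insert i A" for j
    using that
    proof
      assume "j = i"
      then have "of_int (N * b) * r j = of_int (N * a)" using ab by simp
      then show ?thesis by (simp only: Ints_of_int)
    next
      assume "j \<in> A"
      then have "of_int b * (of_int N * r j) \<in> \<int>" by (intro Ints_mult[OF Ints_of_int] N(2))
      then show ?thesis by (simp add: mult_ac)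
    qed
  then show ?case using N(1) ab(1) by (intro exI[of _ "N * b"]) simp
qed

text \<open>Connectedness in terms of two-colourings. In this form it passes to relabelled and
  subdivided graphs by pulling a colouring back, without handling walks.\<close>

lemma (in wf_digraph) connected_iff_locally_constant:
  "Digraph_Component.connected G \<longleftrightarrow> verts G \<noteq> {} \<and>
     (\<forall>P :: 'a \<Rightarrow> bool. (\<forall>e\<in>arcs G. P (tail G e) = P (head G e)) \<longrightarrow>
        (\<forall>u\<in>verts G. \<forall>v\<in>verts G. P u = P v))"
proof -
  define R where "R = rtrancl_on (verts G) (parcs (mk_symmetric G))"
  have conn: "Digraph_Component.connected G \<longleftrightarrow> verts G \<noteq> {} \<and> (\<forall>u\<in>verts G. \<forall>v\<in>verts G. (u, v) \<in> R)"
    by (auto simp: Digraph_Component.connected_def strongly_connected_def reachable_def R_def)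
  have adj: "(b, c) \<in> parcs (mk_symmetric G) \<longleftrightarrow>
      (\<exists>e\<in>arcs G. b = tail G e \<and> c = head G e \<or> c = tail G e \<and> b = head G e)" for b c
    by (auto simp: parcs_mk_symmetric)
  show ?thesis
  proof (rule iffI, (rule conjI, simp add: conn), intro allI impI ballI)
    fix P :: "'a \<Rightarrow> bool" and u v
    assume c: "Digraph_Component.connected G" and P: "\<forall>e\<in>arcs G. P (tail G e) = P (head G e)"
      and uv: "u \<in> verts G" "v \<in> verts G"
    have "(u, v) \<in> R" using c uv conn by auto
    then show "P u = P v"
      unfolding R_def
    proof (induction rule: rtrancl_on.induct)
      case (rtrancl_on_into_rtrancl_on a b c)
      then show ?case using P unfolding adj by metis
    qed auto
  next
    assume a: "verts G \<noteq> {} \<and> (\<forall>P :: 'a \<Rightarrow> bool. (\<forall>e\<in>arcs G. P (tail G e) = P (head G e)) \<longrightarrow>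
        (\<forall>u\<in>verts G. \<forall>v\<in>verts G. P u = P v))"
    have "(u, v) \<in> R" if uv: "u \<in> verts G" "v \<in> verts G" for u v
    proof -
      have step: "(u, c) \<in> R" if "(u, b) \<in> R" "(b, c) \<in> parcs (mk_symmetric G)" for b c
      proof -
        have "c \<in> verts G" using that(2) wellformed unfolding adj by auto
        with that show ?thesis unfolding R_def by (rule rtrancl_on_into_rtrancl_on)
      qed
      \<comment> \<open>The colouring to which the assumption is applied is reachability from u
        itself.\<close>
      have "\<forall>e\<in>arcs G. ((u, tail G e) \<in> R) = ((u, head G e) \<in> R)"
        using step adj by blast
      then have "((u, u) \<in> R) = ((u, v) \<in> R)"
        using a[THEN conjunct2, THEN spec, of "\<lambda>c. (u, c) \<in> R"] uv by blast
      then show ?thesis using uv by (simp add: R_def)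
    qed
    with a show "Digraph_Component.connected G" unfolding conn by simp
  qed
qed

section \<open>Flows, cycles and currents on finite graphs\<close>

context fin_digraph
begin

text \<open>The boundary operator on 1-chains, up to sign: Kirchhoff's law for \<open>C\<close> at v
  is \<open>outflow C v = 0\<close>. A loop contributes nothing. The coefficient ring is left open
  because integral cycles get paired with real increments.\<close>

definition outflow :: "('b \<Rightarrow> 'c :: comm_ring_1) \<Rightarrow> 'a \<Rightarrow> 'c" where
  "outflow C v = (\<Sum>e | e \<in> arcs G \<and> tail G e = v. C e) - (\<Sum>e | e \<in> arcs G \<and> head G e = v. C e)"

lemma outflow_alt:
  "outflow C v = (\<Sum>e\<in>arcs G. (of_bool (tail G e = v) - of_bool (head G e = v)) * C e)"
proof -
  have "(\<Sum>e | e \<in> arcs G \<and> g e = v. C e) = (\<Sum>e\<in>arcs G. of_bool (g e = v) * C e)" for g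
    by (rule sum.mono_neutral_cong_left) auto
  then show ?thesis by (simp add: outflow_def left_diff_distrib sum_subtractf)
qed

text \<open>Summation by parts: boundary and coboundary are adjoint up to sign. It yields both the
  vanishing of the pairing of a gradient with a cycle and the energy identity for currents.\<close>

lemma sum_arcs_by_parts:
  "(\<Sum>e\<in>arcs G. C e * (F (head G e) - F (tail G e))) = - (\<Sum>v\<in>verts G. F v * outflow C v)"
proof -
  have "(\<Sum>v\<in>verts G. F v * (\<Sum>e | e \<in> arcs G \<and> g e = v. C e)) = (\<Sum>e\<in>arcs G. C e * F (g e))"
    if "g ` arcs G \<subseteq> verts G" for g
  proof -
    have "(\<Sum>v\<in>verts G. F v * (\<Sum>e | e \<in> arcs G \<and> g e = v. C e)) =
        (\<Sum>v\<in>verts G. \<Sum>e | e \<in> arcs G \<and> g e = v. C e * F (g e))"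
      by (auto simp: sum_distrib_left mult.commute intro!: sum.cong)
    also have "\<dots> = (\<Sum>e\<in>arcs G. C e * F (g e))"
      using that by (intro sum.group) auto
    finally show ?thesis .
  qed
  from this[of "head G"] this[of "tail G"] show ?thesis
    by (simp add: outflow_def right_diff_distrib sum_subtractf image_subset_iff)
qed

lemma sum_outflow: "(\<Sum>v\<in>verts G. outflow C v) = 0"
  using sum_arcs_by_parts[of C "\<lambda>_. 1"] by simp

end

context metric_graph
begin

lemma verts_nonempty: "verts G \<noteq> {}"
  using connected unfolding connected_iff_locally_constant by (rule conjunct1)

lemma locally_constant_imp_constant:
  fixes P :: "'v \<Rightarrow> bool"
  assumes "\<And>e. e \<in> arcs G \<Longrightarrow> P (tail G e) = P (head G e)" "u \<in> verts G" "v \<in> verts G"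
  shows "P u = P v"
proof -
  have "\<forall>u\<in>verts G. \<forall>v\<in>verts G. P u = P v"
    by (rule connected[unfolded connected_iff_locally_constant, THEN conjunct2, THEN spec, THEN mp])
      (rule ballI, rule assms)
  from this[THEN bspec, OF assms(2), THEN bspec, OF assms(3)] show ?thesis .
qed

text \<open>The outflows add up to zero, so the equation at one vertex follows from the others. The
  remaining #V - 1 equations are fewer than the #E unknowns when the genus is positive.\<close>

lemma exists_cycle:
  assumes "1 \<le> genus G"
  shows "\<exists>C :: 'e \<Rightarrow> int. (\<exists>e\<in>arcs G. C e \<noteq> 0) \<and> (\<forall>v\<in>verts G. outflow C v = 0)"
proof -
  obtain v0 where v0: "v0 \<in> verts G" using verts_nonempty by blast
  moreover have "0 < card (verts G)" using v0 by (auto simp: card_gt_0_iff)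
  ultimately have "card (verts G - {v0}) < card (arcs G)"
    using assms by (simp add: genus_def)
  from integer_system_nontrivial_solution[OF _ finite_arcs this,
      of "\<lambda>v e. of_bool (tail G e = v) - of_bool (head G e = v)"]
  obtain C :: "'e \<Rightarrow> int" where C: "\<exists>e\<in>arcs G. C e \<noteq> 0" "\<forall>v\<in>verts G - {v0}. outflow C v = 0"
    unfolding outflow_alt by auto
  have "outflow C v0 = 0"
    using sum_outflow[of C] C(2) v0 by (simp add: sum.remove)
  with C show ?thesis by (intro exI[of _ C]) auto
qed

text \<open>
  The strength \<open>n\<close> of the current is unknown as well, so that there are more unknowns than Kirchhoff equations
  away from the tail of \<open>e0\<close>; it does not vanish in a nontrivial solution because a potential without currents has energy \<open>0\<close>.
\<close>

lemma exists_current: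
  assumes e0: "e0 \<in> arcs G" and c: "\<And>e. e \<in> arcs G \<Longrightarrow> 0 < c e"
  obtains p :: "'v \<Rightarrow> int" and n :: int where "0 < n"
    "\<And>v. v \<in> verts G \<Longrightarrow> outflow (\<lambda>e. c e * (p (head G e) - p (tail G e))) v =
       n * (of_bool (v = tail G e0) - of_bool (v = head G e0))"
proof -
  define q where "q = tail G e0"
  define W where "W = verts G - {q}"
  have q: "q \<in> verts G" using e0 by (simp add: q_def)
  have W: "finite W" "q \<notin> W" "verts G = insert q W" using q by (auto simp: W_def)
  define flow where "flow p = outflow (\<lambda>e. c e * (p (head G e) - p (tail G e)))" for p :: "'v \<Rightarrow> int"
  \<comment> \<open>\<open>None\<close> stands for the unknown strength n and \<open>Some u\<close>
    for the potential at u. The potential is grounded at q, and q has no equation, so there is one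
    more unknown than equations.\<close>
  define J where "J = insert None (Some ` W)"
  define A where "A v j = (case j of None \<Rightarrow> of_bool (v = head G e0)
    | Some u \<Rightarrow> flow (\<lambda>w. of_bool (w = u)) v)" for v j
  have "card W < card J" using W by (simp add: J_def card_image)
  from integer_system_nontrivial_solution[OF W(1) _ this, of A]
  obtain x where x: "\<exists>j\<in>J. x j \<noteq> 0" "\<forall>v\<in>W. (\<Sum>j\<in>J. A v j * x j) = 0"
    using W(1) unfolding J_def by blast
  define p where "p w = (if w \<in> W then x (Some w) else 0)" for w
  define n where "n = x None"
  have p_sum: "(\<Sum>u\<in>W. of_bool (w = u) * x (Some u)) = p w" for w
    using W(1) by (simp add: p_def of_bool_def if_distrib[where f = "\<lambda>y. y * _"] cong: if_cong)
  have flow_W: "flow p v = - n * of_bool (v = head G e0)" if "v \<in> W" for v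
  proof -
    let ?s = "\<lambda>e. (of_bool (tail G e = v) - of_bool (head G e = v)) * c e"
    have "(\<Sum>u\<in>W. A v (Some u) * x (Some u)) =
        (\<Sum>u\<in>W. \<Sum>e\<in>arcs G. ?s e * (of_bool (head G e = u) * x (Some u) - of_bool (tail G e = u) * x (Some u)))"
      by (simp add: A_def flow_def outflow_alt sum_distrib_right sum_distrib_left algebra_simps)
    also have "\<dots> = (\<Sum>e\<in>arcs G. ?s e * ((\<Sum>u\<in>W. of_bool (head G e = u) * x (Some u)) -
          (\<Sum>u\<in>W. of_bool (tail G e = u) * x (Some u))))"
      by (subst sum.swap) (simp only: sum_distrib_left sum_subtractf[symmetric])
    also have "\<dots> = flow p v"
      by (simp only: p_sum flow_def outflow_alt mult.assoc)
    finally have "(\<Sum>j\<in>J. A v j * x j) = of_bool (v = head G e0) * n + flow p v"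
      using W(1) by (simp add: J_def sum.reindex A_def n_def)
    with bspec[OF x(2) that] show ?thesis by (simp add: algebra_simps)
  qed
  \<comment> \<open>The missing equation at q holds because all outflows add up to zero. If
    \<open>e0\<close> is a loop, both sides are 0 there.\<close>
  have flow_p: "flow p v = n * (of_bool (v = q) - of_bool (v = head G e0))" if "v \<in> verts G" for v
  proof (cases "v = q")
    case True
    have "flow p q = - (\<Sum>v\<in>W. flow p v)"
      using sum_outflow[of "\<lambda>e. c e * (p (head G e) - p (tail G e))"] W
      by (simp add: flow_def eq_neg_iff_add_eq_0)
    also have "\<dots> = n * (\<Sum>v\<in>W. of_bool (v = head G e0))"
      using flow_W by (simp add: sum_distrib_left sum_negf)
    also have "(\<Sum>v\<in>W. of_bool (v = head G e0)) = (of_bool (head G e0 \<in> W) :: int)"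
      using W(1) by (simp add: of_bool_def)
    also have "\<dots> = of_bool (v = q) - of_bool (v = head G e0)"
      using True W e0 head_in_verts[OF e0] by auto
    finally show ?thesis using True by simp
  next
    case False
    then show ?thesis using flow_W[of v] that W by auto
  qed
  have "n \<noteq> 0"
  proof
    assume "n = 0"
    then have "flow p v = 0" if "v \<in> verts G" for v using flow_p[OF that] by simp
    then have "(\<Sum>e\<in>arcs G. (c e * (p (head G e) - p (tail G e))) * (p (head G e) - p (tail G e))) = 0"
      using sum_arcs_by_parts[of "\<lambda>e. c e * (p (head G e) - p (tail G e))" p] by (simp add: flow_def)
    then have "\<forall>e\<in>arcs G. (c e * (p (head G e) - p (tail G e))) * (p (head G e) - p (tail G e)) = 0"
      using c by (subst (asm) sum_nonneg_eq_0_iff) (auto simp: mult.assoc less_imp_le)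
    \<comment> \<open>Zero energy makes p constant along every edge, hence zero by the grounding at
      q; together with n = 0 all unknowns would vanish.\<close>
    then have eq: "p (tail G e) = p (head G e)" if "e \<in> arcs G" for e
      using c[OF that] that by force
    have p0: "p v = 0" if "v \<in> verts G" for v
      using locally_constant_imp_constant[of "\<lambda>v. p v = 0", OF _ that q] eq W(2) by (simp add: p_def)
    have "x (Some v) = 0" if "v \<in> W" for v
      using p0[of v] that W(3) by (simp add: p_def)
    then have "x j = 0" if "j \<in> J" for j
      using that \<open>n = 0\<close> by (auto simp: J_def n_def)
    with x(1) show False by blast
  qed
  \<comment> \<open>The sign of n is absorbed into the potential.\<close>
  have scaled: "outflow (\<lambda>e. c e * (sgn n * p (head G e) - sgn n * p (tail G e))) v =
      \<bar>n\<bar> * (of_bool (v = tail G e0) - of_bool (v = head G e0))" if "v \<in> verts G" for v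
  proof -
    have "outflow (\<lambda>e. c e * (sgn n * p (head G e) - sgn n * p (tail G e))) v = sgn n * flow p v"
      by (simp add: flow_def outflow_alt sum_distrib_left algebra_simps)
    also have "\<dots> = \<bar>n\<bar> * (of_bool (v = tail G e0) - of_bool (v = head G e0))"
      unfolding flow_p[OF that] q_def by (simp add: abs_sgn mult_ac)
    finally show ?thesis .
  qed
  show thesis by (rule that[of "\<bar>n\<bar>" "\<lambda>v. sgn n * p v", OF _ scaled]) (use \<open>n \<noteq> 0\<close> in auto)
qed

lemma exists_potential:
  assumes e0: "e0 \<in> arcs G" and rat: "\<forall>e\<in>arcs G. len e \<in> \<rat>"
  obtains \<phi> :: "'v \<Rightarrow> real" and m :: "'e \<Rightarrow> int" and n :: int where "0 < n"
    "\<And>e. e \<in> arcs G \<Longrightarrow> \<phi> (head G e) - \<phi> (tail G e) = of_int (m e) * len e"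
    "\<And>v. v \<in> verts G \<Longrightarrow> outflow m v = n * (of_bool (v = tail G e0) - of_bool (v = head G e0))"
proof -
  obtain N :: int where N: "0 < N" "\<And>e. e \<in> arcs G \<Longrightarrow> of_int N * len e \<in> \<int>"
    using common_denominator[OF finite_arcs, of len] rat by blast
  define L where "L e = \<lfloor>of_int N * len e\<rfloor>" for e
  have L: "of_int (L e) = of_int N * len e" if "e \<in> arcs G" for e
    using N(2)[OF that] by (auto simp: L_def elim: Ints_cases)
  have L_pos: "0 < L e" if "e \<in> arcs G" for e
  proof -
    have "0 < real_of_int (L e)" unfolding L[OF that] using N(1) len_pos[OF that] by simp
    then show ?thesis by simp
  qed
  \<comment> \<open>The product of the other scaled lengths is an integral conductance:
    \<open>c e * len e\<close> is the same number \<open>K\<close> for all edges. Hence c e times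
    the increment of p is at once the current in e and the slope of the potential K * p.\<close>
  define c where "c e = (\<Prod>e'\<in>arcs G - {e}. L e')" for e
  define K where "K = real_of_int (\<Prod>e\<in>arcs G. L e) / of_int N"
  have c: "of_int (c e) * len e = K" if "e \<in> arcs G" for e
  proof -
    have "(\<Prod>e\<in>arcs G. L e) = L e * c e" using that by (simp add: c_def prod.remove)
    then show ?thesis using N(1) by (simp add: K_def L[OF that] field_simps)
  qed
  have "0 < c e" for e using L_pos by (auto simp: c_def intro!: prod_pos)
  then obtain p :: "'v \<Rightarrow> int" and n where n: "0 < n"
    "\<And>v. v \<in> verts G \<Longrightarrow> outflow (\<lambda>e. c e * (p (head G e) - p (tail G e))) v =
       n * (of_bool (v = tail G e0) - of_bool (v = head G e0))"
    using exists_current[OF e0, of c] by blast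
  show thesis
  proof (rule that[of n "\<lambda>v. K * of_int (p v)" "\<lambda>e. c e * (p (head G e) - p (tail G e))"])
    show "K * of_int (p (head G e)) - K * of_int (p (tail G e)) =
        of_int (c e * (p (head G e) - p (tail G e))) * len e" if "e \<in> arcs G" for e
      unfolding c[OF that, symmetric] by (simp add: algebra_simps)
  qed (use n in auto)
qed

end


section \<open>Local geometry of metric graphs\<close>

context metric_graph
begin

lemma points_alt:
  "points G len = Vertex ` verts G \<union> {Interior e t |e t. e \<in> arcs G \<and> 0 < t \<and> t < len e}"
proof -
  have "edge_pt G len e t \<in> Vertex ` verts G \<union> {Interior e t |e t. e \<in> arcs G \<and> 0 < t \<and> t < len e}"
    if "e \<in> arcs G" for e t
    using that wellformed by (auto simp: edge_pt_def)
  moreover have "Interior e t \<in> points G len" if "e \<in> arcs G" "0 < t" "t < len e" for e t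
    using that edge_pt_in_points[of e t] by (simp add: edge_pt_def)
  ultimately show ?thesis unfolding points_def by blast
qed

lemma edge_pt_0 [simp]: "edge_pt G len e 0 = Vertex (tail G e)"
  by (simp add: edge_pt_def)

lemma edge_pt_len [simp]: "e \<in> arcs G \<Longrightarrow> edge_pt G len e (len e) = Vertex (head G e)"
  using len_pos[of e] by (simp add: edge_pt_def)

lemma edge_pt_Interior [simp]: "0 < t \<Longrightarrow> t < len e \<Longrightarrow> edge_pt G len e t = Interior e t"
  by (simp add: edge_pt_def)

section \<open>Lower bounds on distances by test functions\<close>

lemma path_dist_commute: "path_dist G len x y = path_dist G len y x"
  using Metric_space_path_dist by (rule Metric_space.commute)

text \<open>A function that is 1-Lipschitz on each closed edge is so along every broken path. As
  distances are infima, the lower bounds below come from choosing such a test function.\<close>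

lemma path_dist_lipschitz:
  assumes "x \<in> points G len" "y \<in> points G len"
    and "\<And>e s t. e \<in> arcs G \<Longrightarrow> 0 \<le> s \<Longrightarrow> s \<le> len e \<Longrightarrow> 0 \<le> t \<Longrightarrow> t \<le> len e \<Longrightarrow>
       F (edge_pt G len e t) - F (edge_pt G len e s) \<le> \<bar>t - s\<bar>"
  shows "F y - F x \<le> path_dist G len x y"
  using broken_path_lipschitz[where F = F] assms by (intro path_dist_ge) auto

lemma path_dist_segment_le:
  assumes "e \<in> arcs G" "0 \<le> s" "s \<le> len e" "0 \<le> t" "t \<le> len e"
  shows "path_dist G len (edge_pt G len e s) (edge_pt G len e t) \<le> \<bar>t - s\<bar>"
  using assms by (intro path_dist_le broken_path_segment)

text \<open>
  The distance to the point at parameter \<open>t\<close> of \<open>e\<close> in the circle obtained from \<open>\<Gamma>\<close> by contracting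
  everything but the edge \<open>e\<close>.
\<close>

definition circle_dist :: "'e \<Rightarrow> real \<Rightarrow> ('v, 'e) point \<Rightarrow> real" where
  "circle_dist e t z = (case z of Vertex v \<Rightarrow> min t (len e - t)
     | Interior e' u \<Rightarrow> if e' = e then min \<bar>u - t\<bar> (len e - \<bar>u - t\<bar>) else min t (len e - t))"

lemma circle_dist_edge_pt:
  assumes "0 \<le> t" "t \<le> len e" "0 \<le> u" "u \<le> len e'"
  shows "circle_dist e t (edge_pt G len e' u) =
    (if e' = e then min \<bar>u - t\<bar> (len e - \<bar>u - t\<bar>) else min t (len e - t))"
  using assms by (auto simp: circle_dist_def edge_pt_def)

lemma circle_dist_le:
  assumes e: "e \<in> arcs G" "0 \<le> t" "t \<le> len e" and z: "z \<in> points G len"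
  shows "circle_dist e t z \<le> path_dist G len (edge_pt G len e t) z"
proof -
  have "circle_dist e t z - circle_dist e t (edge_pt G len e t) \<le> path_dist G len (edge_pt G len e t) z"
    using e z by (intro path_dist_lipschitz edge_pt_in_points) (auto simp: circle_dist_edge_pt)
  moreover have "circle_dist e t (edge_pt G len e t) = 0"
    using e by (simp add: circle_dist_edge_pt)
  ultimately show ?thesis by simp
qed

text \<open>Contracting the rest of the graph can only shorten distances, and in a circle an arc of
  at most half the length is a shortest path. Past one half, the other way round a loop would be
  shorter.\<close>

lemma path_dist_short_segment:
  assumes e: "e \<in> arcs G" "0 \<le> s" "s \<le> len e" "0 \<le> t" "t \<le> len e" "\<bar>t - s\<bar> \<le> len e / 2"
  shows "path_dist G len (edge_pt G len e s) (edge_pt G len e t) = \<bar>t - s\<bar>"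
proof (rule antisym)
  have "min \<bar>t - s\<bar> (len e - \<bar>t - s\<bar>) \<le> path_dist G len (edge_pt G len e s) (edge_pt G len e t)"
    using circle_dist_le[of e s "edge_pt G len e t"] e by (simp add: circle_dist_edge_pt edge_pt_in_points)
  with e show "\<bar>t - s\<bar> \<le> path_dist G len (edge_pt G len e s) (edge_pt G len e t)" by (auto simp: min_def split: if_splits)
qed (use e in \<open>auto intro: path_dist_segment_le\<close>)

text \<open>A bump supported in the single edge \<open>e\<close>. It is 1-Lipschitz once its support
  fits into the edge, and it serves to keep the different directions at a point apart.\<close>

definition tent :: "'e \<Rightarrow> real \<Rightarrow> real \<Rightarrow> ('v, 'e) point \<Rightarrow> real" where
  "tent e c r z = (case z of Vertex v \<Rightarrow> 0 | Interior e' u \<Rightarrow> if e' = e then max 0 (r - \<bar>u - c\<bar>) else 0)"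

lemma tent_edge_pt:
  assumes "r \<le> c" "c + r \<le> len e" "0 \<le> u" "u \<le> len e'"
  shows "tent e c r (edge_pt G len e' u) = (if e' = e then max 0 (r - \<bar>u - c\<bar>) else 0)"
  using assms by (auto simp: tent_def edge_pt_def)

lemma tent_le_path_dist:
  assumes "r \<le> c" "c + r \<le> len e" "x \<in> points G len" "y \<in> points G len" "tent e c r y = 0"
  shows "tent e c r x \<le> path_dist G len x y"
proof -
  have "tent e c r x - tent e c r y \<le> path_dist G len y x"
    using assms by (intro path_dist_lipschitz) (auto simp: tent_edge_pt)
  then show ?thesis using assms by (simp add: path_dist_commute)
qed

section \<open>Directions and star-shaped neighbourhoods\<close>

lemma directions_Interior:
  assumes "e \<in> arcs G" "0 < t" "t < len e"
  shows "directions G len (Interior e t) = {(e, t, 1), (e, t, -1)}"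
  using assms by (auto simp: directions_def edge_pt_def split: if_splits)

lemma directions_Vertex:
  "directions G len (Vertex v) = (\<lambda>e. (e, 0, 1)) ` {e \<in> arcs G. tail G e = v} \<union>
     (\<lambda>e. (e, len e, -1)) ` {e \<in> arcs G. head G e = v}"
  using len_pos by (force simp: directions_def edge_pt_def split: if_splits)

lemma finite_directions:
  assumes "x \<in> points G len"
  shows "finite (directions G len x)"
  using assms by (auto simp: points_alt directions_Vertex directions_Interior)

text \<open>Below this radius \<open>circle_dist\<close> excludes the vertices and all other edges.
  On e, the alternative value \<open>len e - \<bar>u - t\<bar>\<close> is at least
  \<open>min t (len e - t)\<close>, hence too large, which leaves
  \<open>\<bar>u - t\<bar>\<close>.\<close>

lemma star_neighbourhood_Interior:
  assumes e: "e \<in> arcs G" "0 < t" "t < len e" and z: "z \<in> points G len"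
    and d: "path_dist G len (Interior e t) z < min t (len e - t) / 2"
  shows "\<exists>s\<in>{1, -1}. z = edge_pt G len e (t + s * path_dist G len (Interior e t) z)"
proof -
  let ?d = "path_dist G len (Interior e t) z"
  have F: "circle_dist e t z \<le> ?d"
    using circle_dist_le[of e t z] e z by simp
  then have *: "circle_dist e t z < min t (len e - t) / 2" using d by linarith
  have "z \<notin> range Vertex"
    using * e by (auto simp: circle_dist_def)
  then obtain e' u where u: "z = Interior e' u" "0 < u" "u < len e'"
    using z by (auto simp: points_alt)
  have "e' = e" using * e u by (auto simp: circle_dist_def split: if_splits)
  with u have u: "z = Interior e u" "0 < u" "u < len e" by auto
  have "\<bar>u - t\<bar> \<le> max t (len e - t)" using u e by auto
  then have "\<bar>u - t\<bar> \<le> ?d"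
    using F * e u by (auto simp: circle_dist_def min_def max_def split: if_splits)
  moreover have "?d \<le> \<bar>u - t\<bar>"
    using path_dist_segment_le[of e t u] u e by simp
  ultimately have "?d = \<bar>u - t\<bar>" by simp
  then have "u = t + 1 * ?d \<or> u = t + (-1) * ?d" by linarith
  then show ?thesis using u by force
qed

lemma star_neighbourhood_Vertex:
  assumes v: "v \<in> verts G" and z: "z \<in> points G len" "z \<noteq> Vertex v"
    and \<epsilon>: "0 < \<epsilon>" "\<And>e. e \<in> arcs G \<Longrightarrow> 2 * \<epsilon> \<le> len e"
    and d: "path_dist G len (Vertex v) z < \<epsilon>"
  shows "\<exists>(e, t, s)\<in>directions G len (Vertex v). z = edge_pt G len e (t + s * path_dist G len (Vertex v) z)"
proof -
  let ?d = "path_dist G len (Vertex v) z"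
  \<comment> \<open>The distance to v, truncated at \<epsilon>. As 2 * \<epsilon> \<le>
    \<open>len e\<close>, the two ends of a loop at v do not interfere.\<close>
  define F where "F y = (case y of Vertex w \<Rightarrow> if w = v then 0 else \<epsilon>
    | Interior e t \<Rightarrow> min \<epsilon> (min (if tail G e = v then t else \<epsilon>) (if head G e = v then len e - t else \<epsilon>)))"
    for y :: "('v, 'e) point"
  have F: "F (edge_pt G len e t) =
      min \<epsilon> (min (if tail G e = v then t else \<epsilon>) (if head G e = v then len e - t else \<epsilon>))"
    if "e \<in> arcs G" "0 \<le> t" "t \<le> len e" for e t
    using that \<epsilon>(1) \<epsilon>(2)[OF that(1)] by (auto simp: F_def edge_pt_def)
  have "F z - F (Vertex v) \<le> ?d"
    using v z by (intro path_dist_lipschitz) (auto simp: F points_alt)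
  then have Fz: "F z \<le> ?d" by (simp add: F_def)
  with z d obtain e u where u: "z = Interior e u" "e \<in> arcs G" "0 < u" "u < len e"
    by (auto simp: points_alt F_def split: if_splits)
  have tl: "?d \<le> u" if "tail G e = v"
    using path_dist_segment_le[of e 0 u] u that by simp
  have hd: "?d \<le> len e - u" if "head G e = v"
    using path_dist_segment_le[of e "len e" u] u that by simp
  from Fz d u have "tail G e = v \<and> u \<le> ?d \<or> head G e = v \<and> len e - u \<le> ?d"
    by (auto simp: F_def split: if_splits)
  then consider "tail G e = v" "u = ?d" | "head G e = v" "u = len e - ?d"
    using tl hd by force
  then show ?thesis
  proof cases
    case 1
    then show ?thesis using u by (intro bexI[of _ "(e, 0, 1)"]) (auto simp: directions_Vertex)
  next
    case 2
    then show ?thesis using u by (intro bexI[of _ "(e, len e, -1)"]) (auto simp: directions_Vertex)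
  qed
qed

text \<open>Near p the graph is a star with one leg per direction. The separation of different legs
  is what later keeps the isometric image of a short segment from switching legs.\<close>

lemma star_neighbourhood:
  assumes p: "p \<in> points G len"
  obtains \<epsilon> where "0 < \<epsilon>"
    "\<And>z. z \<in> points G len \<Longrightarrow> z \<noteq> p \<Longrightarrow> path_dist G len p z < \<epsilon> \<Longrightarrow>
      \<exists>(e, t, s)\<in>directions G len p. z = edge_pt G len e (t + s * path_dist G len p z)"
    "\<And>e t s r. (e, t, s) \<in> directions G len p \<Longrightarrow> 0 \<le> r \<Longrightarrow> r < \<epsilon> \<Longrightarrow> 0 \<le> t + s * r \<and> t + s * r \<le> len e"
    "\<And>e t s r e' t' s' r'. (e, t, s) \<in> directions G len p \<Longrightarrow> (e', t', s') \<in> directions G len p \<Longrightarrow>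
      (e, t, s) \<noteq> (e', t', s') \<Longrightarrow> 0 < r \<Longrightarrow> 2 * r < \<epsilon> \<Longrightarrow> 0 < r' \<Longrightarrow> 2 * r' < \<epsilon> \<Longrightarrow>
      r \<le> path_dist G len (edge_pt G len e (t + s * r)) (edge_pt G len e' (t' + s' * r'))"
proof -
  obtain \<epsilon> where \<epsilon>: "0 < \<epsilon>"
    and star: "\<And>z. z \<in> points G len \<Longrightarrow> z \<noteq> p \<Longrightarrow> path_dist G len p z < \<epsilon> \<Longrightarrow>
      \<exists>(e, t, s)\<in>directions G len p. z = edge_pt G len e (t + s * path_dist G len p z)"
    and room: "\<And>e t s r. (e, t, s) \<in> directions G len p \<Longrightarrow> 0 \<le> r \<Longrightarrow> r \<le> \<epsilon> \<Longrightarrow> 0 \<le> t + s * r \<and> t + s * r \<le> len e"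
    and apart: "\<And>e t s t' s' r. (e, t, s) \<in> directions G len p \<Longrightarrow> (e, t', s') \<in> directions G len p \<Longrightarrow>
      (t, s) \<noteq> (t', s') \<Longrightarrow> 0 < r \<Longrightarrow> 2 * r < \<epsilon> \<Longrightarrow> \<epsilon> / 2 \<le> \<bar>t' + s' * r - (t + s * (\<epsilon> / 2))\<bar>"
  proof (cases p)
    case (Interior e0 t0)
    then have e0: "e0 \<in> arcs G" "0 < t0" "t0 < len e0" using p by (auto simp: points_alt)
    show thesis
    proof (rule that[of "min t0 (len e0 - t0) / 2"])
      fix z assume "z \<in> points G len" "path_dist G len p z < min t0 (len e0 - t0) / 2"
      with star_neighbourhood_Interior[OF e0, of z]
      show "\<exists>(e, t, s)\<in>directions G len p. z = edge_pt G len e (t + s * path_dist G len p z)"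
        using e0 by (auto simp: Interior directions_Interior)
    qed (use e0 in \<open>auto simp: Interior directions_Interior\<close>)
  next
    case (Vertex v)
    define \<epsilon> where "\<epsilon> = Min (insert 1 (len ` arcs G)) / 2"
    have \<epsilon>: "0 < \<epsilon>"
      using len_pos by (auto simp: \<epsilon>_def)
    have \<epsilon>2: "2 * \<epsilon> \<le> len e" if "e \<in> arcs G" for e
      using that by (auto simp: \<epsilon>_def intro!: Min_le)
    show thesis
    proof (rule that[of \<epsilon>, OF \<epsilon>])
      show "\<exists>(e, t, s)\<in>directions G len p. z = edge_pt G len e (t + s * path_dist G len p z)"
        if "z \<in> points G len" "z \<noteq> p" "path_dist G len p z < \<epsilon>" for z
        using star_neighbourhood_Vertex[of v z \<epsilon>] that \<epsilon> \<epsilon>2 p by (auto simp: Vertex points_alt)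
      show "0 \<le> t + s * r \<and> t + s * r \<le> len e"
        if "(e, t, s) \<in> directions G len p" "0 \<le> r" "r \<le> \<epsilon>" for e t s r
        using that \<epsilon>2 \<epsilon> by (fastforce simp: Vertex directions_Vertex)
      show "\<epsilon> / 2 \<le> \<bar>t' + s' * r - (t + s * (\<epsilon> / 2))\<bar>"
        if "(e, t, s) \<in> directions G len p" "(e, t', s') \<in> directions G len p" "(t, s) \<noteq> (t', s')"
          "0 < r" "2 * r < \<epsilon>" for e t s t' s' r
      proof -
        have "2 * \<epsilon> \<le> len e" using that(1) \<epsilon>2 by (auto simp: directions_def)
        then show ?thesis using that \<epsilon> by (auto simp: Vertex directions_Vertex)
      qed
    qed
  qed
  show thesis
  proof (rule that[OF \<epsilon> star])
    fix e t s r e' t' s' r'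
    assume dirs: "(e, t, s) \<in> directions G len p" "(e', t', s') \<in> directions G len p"
      and ne: "(e, t, s) \<noteq> (e', t', s')" and r: "0 < r" "2 * r < \<epsilon>" "0 < r'" "2 * r' < \<epsilon>"
    \<comment> \<open>A tent of radius \<epsilon> / 2 centred at distance \<epsilon> / 2 on the
      first leg has its foot exactly at p: it takes the value r at distance r and vanishes on the
      nearby part of every other leg.\<close>
    let ?c = "t + s * (\<epsilon> / 2)"
    have arcs: "e \<in> arcs G" "e' \<in> arcs G" "s = 1 \<or> s = -1" using dirs by (auto simp: directions_def)
    have c: "\<epsilon> / 2 \<le> ?c" "?c + \<epsilon> / 2 \<le> len e"
      using room[OF dirs(1), of 0] room[OF dirs(1), of \<epsilon>] arcs \<epsilon> by (auto simp: field_simps)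
    have in1: "0 \<le> t + s * r" "t + s * r \<le> len e"
      using room[OF dirs(1), of r] r by auto
    have in2: "0 \<le> t' + s' * r'" "t' + s' * r' \<le> len e'"
      using room[OF dirs(2), of r'] r by auto
    have "tent e ?c (\<epsilon> / 2) (edge_pt G len e (t + s * r)) = r"
      using c in1 r arcs by (subst tent_edge_pt) (auto simp: field_simps)
    moreover have "tent e ?c (\<epsilon> / 2) (edge_pt G len e' (t' + s' * r')) = 0"
      using c in2 r apart[of e t s t' s' r'] dirs ne by (subst tent_edge_pt) auto
    ultimately show "r \<le> path_dist G len (edge_pt G len e (t + s * r)) (edge_pt G len e' (t' + s' * r'))"
      using tent_le_path_dist[OF c, of "edge_pt G len e (t + s * r)" "edge_pt G len e' (t' + s' * r')"]
        arcs in1 in2 by (simp add: edge_pt_in_points)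
  qed (use room in auto)
qed

end


section \<open>Refinements\<close>

text \<open>Paths are compared rather than distances: edges of H are translates of parts of edges of
  G, and segments in G lift to paths of the same length in H. Corresponding points therefore have
  the same set of path lengths, so isometry needs no computation of infima, and refinements
  compose.\<close>

definition refines ::
    "('v, 'e) pre_digraph \<Rightarrow> ('e \<Rightarrow> real) \<Rightarrow> ('w, 'f) pre_digraph \<Rightarrow> ('f \<Rightarrow> real) \<Rightarrow>
     (('w, 'f) point \<Rightarrow> ('v, 'e) point) \<Rightarrow> bool" where
  "refines G len H len' \<phi> \<longleftrightarrow> metric_graph G len \<and> metric_graph H len' \<and>
     bij_betw \<phi> (points H len') (points G len) \<and>
     (\<forall>e'\<in>arcs H. \<exists>e\<in>arcs G. \<exists>c\<ge>0. c + len' e' \<le> len e \<and>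
        (\<forall>t. 0 \<le> t \<longrightarrow> t \<le> len' e' \<longrightarrow> \<phi> (edge_pt H len' e' t) = edge_pt G len e (c + t))) \<and>
     (\<forall>e\<in>arcs G. \<forall>s t. 0 \<le> s \<longrightarrow> s \<le> t \<longrightarrow> t \<le> len e \<longrightarrow>
        (\<forall>x\<in>points H len'. \<forall>y\<in>points H len'. \<phi> x = edge_pt G len e s \<longrightarrow> \<phi> y = edge_pt G len e t \<longrightarrow>
           broken_path H len' x y (t - s)))"

lemma
  assumes "refines G len H len' \<phi>"
  shows refines_metric_graph: "metric_graph G len"
    and refines_metric_graph': "metric_graph H len'"
    and refines_bij: "bij_betw \<phi> (points H len') (points G len)"
  using assms unfolding refines_def by blast+

lemma refines_broken_path:
  assumes "refines G len H len' \<phi>" "broken_path H len' x y r"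
  shows "broken_path G len (\<phi> x) (\<phi> y) r"
  using assms(2)
proof (induction rule: broken_path.induct)
  case (start x)
  then show ?case using bij_betwE[OF refines_bij[OF assms(1)]] by (intro broken_path.start) auto
next
  case (step x e' s r t)
  obtain e c where e: "e \<in> arcs G" "0 \<le> c" "c + len' e' \<le> len e"
    "\<And>t. 0 \<le> t \<Longrightarrow> t \<le> len' e' \<Longrightarrow> \<phi> (edge_pt H len' e' t) = edge_pt G len e (c + t)"
    using assms(1) step.hyps(2) unfolding refines_def by meson
  have "broken_path G len (\<phi> x) (edge_pt G len e (c + t)) (r + \<bar>(c + t) - (c + s)\<bar>)"
    using step e by (intro broken_path.step) auto
  then show ?case using step e by simp
qed

lemma refines_broken_path_lift:
  assumes "refines G len H len' \<phi>" "broken_path G len (\<phi> x) (\<phi> y) r"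
    "x \<in> points H len'" "y \<in> points H len'"
  shows "broken_path H len' x y r"
proof -
  interpret G: metric_graph G len using assms(1) by (rule refines_metric_graph)
  interpret H: metric_graph H len' using assms(1) by (rule refines_metric_graph')
  have bij: "bij_betw \<phi> (points H len') (points G len)" using assms(1) by (rule refines_bij)
  have seg: "broken_path H len' x y \<bar>t - s\<bar>"
    if "e \<in> arcs G" "0 \<le> s" "s \<le> len e" "0 \<le> t" "t \<le> len e" "x \<in> points H len'" "y \<in> points H len'"
      "\<phi> x = edge_pt G len e s" "\<phi> y = edge_pt G len e t" for e s t x y
  proof (cases "s \<le> t")
    case True
    then have "broken_path H len' x y (t - s)" using that assms(1) unfolding refines_def by blast
    with True show ?thesis by simp
  next
    case False
    then have "broken_path H len' y x (s - t)" using that assms(1) unfolding refines_def by force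
    from H.broken_path_sym[OF this] False show ?thesis by simp
  qed
  have "\<forall>y\<in>points H len'. \<phi> y = b \<longrightarrow> broken_path H len' x y r" if "broken_path G len a b r" "a = \<phi> x" for a b r
    using that
  proof (induction rule: broken_path.induct)
    case (start a)
    then show ?case using assms(3) bij
      by (auto intro: broken_path.start simp: bij_betw_def dest: inj_onD)
  next
    case (step a e s r t)
    have "edge_pt G len e s \<in> points G len" using step by (simp add: G.edge_pt_in_points)
    then obtain z where z: "z \<in> points H len'" "\<phi> z = edge_pt G len e s"
      using bij by (metis bij_betw_iff_bijections)
    with step have "broken_path H len' x z r" by auto
    then show ?case using seg z step H.broken_path_trans by blast
  qed
  with assms show ?thesis by blast
qed

lemma refines_is_model:
  assumes "refines G len H len' \<phi>"
  shows "is_model (points G len) (path_dist G len) H len' \<phi>"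
proof -
  have bij: "bij_betw \<phi> (points H len') (points G len)" using assms by (rule refines_bij)
  have "broken_path G len (\<phi> x) (\<phi> y) = broken_path H len' x y"
    if "x \<in> points H len'" "y \<in> points H len'" for x y
    using refines_broken_path[OF assms] refines_broken_path_lift[OF assms] that by blast
  then show ?thesis
    unfolding is_model_def using refines_metric_graph'[OF assms] bij bij_betwE[OF bij]
    by (simp add: path_dist_def)
qed

lemma refines_trans:
  assumes 1: "refines G len H len' \<phi>" and 2: "refines H len' K len'' \<psi>"
  shows "refines G len K len'' (\<phi> \<circ> \<psi>)"
  unfolding refines_def
proof (intro conjI ballI allI impI)
  show "metric_graph G len" "metric_graph K len''"
    using refines_metric_graph[OF 1] refines_metric_graph'[OF 2] .
  show "bij_betw (\<phi> \<circ> \<psi>) (points K len'') (points G len)"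
    using bij_betw_trans[OF refines_bij[OF 2] refines_bij[OF 1]] .
next
  fix e' assume "e' \<in> arcs K"
  then obtain e c where e: "e \<in> arcs H" "0 \<le> c" "c + len'' e' \<le> len' e"
    "\<And>t. 0 \<le> t \<Longrightarrow> t \<le> len'' e' \<Longrightarrow> \<psi> (edge_pt K len'' e' t) = edge_pt H len' e (c + t)"
    using 2 unfolding refines_def by meson
  then obtain f d where f: "f \<in> arcs G" "0 \<le> d" "d + len' e \<le> len f"
    "\<And>t. 0 \<le> t \<Longrightarrow> t \<le> len' e \<Longrightarrow> \<phi> (edge_pt H len' e t) = edge_pt G len f (d + t)"
    using 1 unfolding refines_def by meson
  show "\<exists>e\<in>arcs G. \<exists>c\<ge>0. c + len'' e' \<le> len e \<and>
        (\<forall>t\<ge>0. t \<le> len'' e' \<longrightarrow> (\<phi> \<circ> \<psi>) (edge_pt K len'' e' t) = edge_pt G len e (c + t))"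
    using e f by (intro bexI[of _ f] exI[of _ "d + c"]) (auto simp: add.assoc)
next
  fix e s t x y
  assume a: "e \<in> arcs G" "0 \<le> s" "s \<le> t" "t \<le> len e" "x \<in> points K len''" "y \<in> points K len''"
    "(\<phi> \<circ> \<psi>) x = edge_pt G len e s" "(\<phi> \<circ> \<psi>) y = edge_pt G len e t"
  then have "\<psi> x \<in> points H len'" "\<psi> y \<in> points H len'"
    using bij_betwE[OF refines_bij[OF 2]] by auto
  with a 1 have "broken_path H len' (\<psi> x) (\<psi> y) (t - s)" unfolding refines_def comp_def by blast
  from refines_broken_path_lift[OF 2 this] a show "broken_path K len'' x y (t - s)" by simp
qed

section \<open>Relabelling and subdivision\<close>

context metric_graph
begin

text \<open>Transport of structure. With natural numbers as names it gives the type of graph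
  required in \<open>PL_Z\<close> and an unlimited supply of fresh names for subdivisions.\<close>

lemma refines_relabel:
  fixes \<alpha> :: "'v \<Rightarrow> 'w" and \<beta> :: "'e \<Rightarrow> 'f"
  assumes "inj_on \<alpha> (verts G)" "inj_on \<beta> (arcs G)"
  defines "\<alpha>' \<equiv> inv_into (verts G) \<alpha>" and "\<beta>' \<equiv> inv_into (arcs G) \<beta>"
  shows "refines G len \<lparr>verts = \<alpha> ` verts G, arcs = \<beta> ` arcs G,
      tail = \<lambda>e. \<alpha> (tail G (\<beta>' e)), head = \<lambda>e. \<alpha> (head G (\<beta>' e))\<rparr> (len \<circ> \<beta>') (map_point \<alpha>' \<beta>')"
    (is "refines G len ?H ?len ?\<phi>")
proof -
  have inv: "\<alpha>' (\<alpha> v) = v" if "v \<in> verts G" for v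
    using that assms by simp
  have inv': "\<beta>' (\<beta> e) = e" if "e \<in> arcs G" for e
    using that assms by simp
  interpret H: fin_digraph ?H
  proof unfold_locales
    show "tail ?H e \<in> verts ?H" "head ?H e \<in> verts ?H" if "e \<in> arcs ?H" for e
      using that by (auto simp: inv' intro!: imageI)
  qed simp_all
  have "Digraph_Component.connected ?H"
    unfolding H.connected_iff_locally_constant
  proof (intro conjI allI impI)
    show "verts ?H \<noteq> {}" using verts_nonempty by simp
    fix P :: "'w \<Rightarrow> bool"
    assume P: "\<forall>e\<in>arcs ?H. P (tail ?H e) = P (head ?H e)"
    have P: "P (\<alpha> (tail G e)) = P (\<alpha> (head G e))" if "e \<in> arcs G" for e
      using bspec[OF P, of "\<beta> e"] that by (simp add: inv')
    show "\<forall>u\<in>verts ?H. \<forall>v\<in>verts ?H. P u = P v"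
    proof (intro ballI)
      fix u v assume "u \<in> verts ?H" "v \<in> verts ?H"
      then obtain u' v' where "u' \<in> verts G" "v' \<in> verts G" "u = \<alpha> u'" "v = \<alpha> v'" by auto
      with locally_constant_imp_constant[of "\<lambda>v. P (\<alpha> v)", OF P] show "P u = P v" by blast
    qed
  qed
  then interpret H: metric_graph ?H ?len by unfold_locales (auto simp: inv' len_pos)
  have ept: "?\<phi> (edge_pt ?H ?len (\<beta> e) t) = edge_pt G len e t" if "e \<in> arcs G" for e t
    using that by (simp add: edge_pt_def inv inv')
  have "inj_on ?\<phi> (points ?H ?len)"
    by (rule inj_onI) (auto simp: H.points_alt inv inv')
  moreover have "?\<phi> ` points ?H ?len = points G len"
  proof (intro equalityI subsetI)
    fix x assume "x \<in> points G len"
    then consider v where "v \<in> verts G" "x = ?\<phi> (Vertex (\<alpha> v))"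
      | e t where "e \<in> arcs G" "0 < t" "t < len e" "x = ?\<phi> (Interior (\<beta> e) t)"
      by (auto simp: points_alt inv inv')
    then show "x \<in> ?\<phi> ` points ?H ?len"
    proof cases
      case 1
      then show ?thesis by (auto intro!: image_eqI[of _ _ "Vertex (\<alpha> v)"] simp: H.points_alt)
    next
      case 2
      then show ?thesis
        by (auto intro!: image_eqI[of _ _ "Interior (\<beta> e) t"] simp: H.points_alt inv')
    qed
  qed (auto simp: points_alt H.points_alt inv inv')
  ultimately have bij: "bij_betw ?\<phi> (points ?H ?len) (points G len)"
    by (simp add: bij_betw_def)
  show ?thesis
    unfolding refines_def
  proof (intro conjI ballI allI impI)
    show "metric_graph G len" "metric_graph ?H ?len" by unfold_locales
    fix e' assume "e' \<in> arcs ?H"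
    then obtain e where "e \<in> arcs G" "e' = \<beta> e" by auto
    then show "\<exists>e\<in>arcs G. \<exists>c\<ge>0. c + ?len e' \<le> len e \<and> (\<forall>t\<ge>0. t \<le> ?len e' \<longrightarrow>
        ?\<phi> (edge_pt ?H ?len e' t) = edge_pt G len e (c + t))"
      using ept by (intro bexI[of _ e] exI[of _ 0]) (auto simp: inv')
  next
    fix e s t x y
    assume e: "e \<in> arcs G" "0 \<le> s" "s \<le> t" "t \<le> len e" and xy: "x \<in> points ?H ?len" "y \<in> points ?H ?len"
      and eq: "?\<phi> x = edge_pt G len e s" "?\<phi> y = edge_pt G len e t"
    have "edge_pt ?H ?len (\<beta> e) u \<in> points ?H ?len" if "0 \<le> u" "u \<le> len e" for u
      using that e by (intro H.edge_pt_in_points) (auto simp: inv')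
    then have "x = edge_pt ?H ?len (\<beta> e) s" "y = edge_pt ?H ?len (\<beta> e) t"
      using bij_betw_imp_inj_on[OF bij, THEN inj_onD] xy eq ept e by auto
    then show "broken_path ?H ?len x y (t - s)"
      using H.broken_path_segment[of "\<beta> e" s t] e by (simp add: inv')
  qed (use bij in auto)
qed

text \<open>The arc \<open>e0\<close> is reused for the part before s0, so that only the new vertex
  w and the arc a for the part after it need fresh names.\<close>

lemma refines_subdivision:
  assumes e0: "e0 \<in> arcs G" "0 < s0" "s0 < len e0" and new: "w \<notin> verts G" "a \<notin> arcs G"
  defines "H \<equiv> \<lparr>verts = insert w (verts G), arcs = insert a (arcs G),
      tail = (tail G)(a := w), head = (head G)(a := head G e0, e0 := w)\<rparr>"
    and "len' \<equiv> len(e0 := s0, a := len e0 - s0)"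
    and "\<phi> \<equiv> (\<lambda>x. case x of Vertex v \<Rightarrow> if v = w then Interior e0 s0 else Vertex v
      | Interior e t \<Rightarrow> if e = a then Interior e0 (s0 + t) else Interior e t)"
  shows "refines G len H len' \<phi>"
proof -
  have ne: "a \<noteq> e0" using e0 new by auto
  have tail_ne: "tail G e \<noteq> w" "head G e \<noteq> w" if "e \<in> arcs G" for e
    using that new tail_in_verts head_in_verts by metis+
  interpret H: fin_digraph H
    by unfold_locales (use e0 in \<open>auto simp: H_def\<close>)
  have "Digraph_Component.connected H"
    unfolding H.connected_iff_locally_constant
  proof (intro conjI allI impI)
    show "verts H \<noteq> {}" by (simp add: H_def)
    fix P :: "'v \<Rightarrow> bool"
    assume P: "\<forall>e\<in>arcs H. P (tail H e) = P (head H e)"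
    have e0': "P (tail G e0) = P w" "P w = P (head G e0)"
      using P[rule_format, of e0] P[rule_format, of a] e0 ne by (auto simp: H_def)
    moreover have "P (tail G e) = P (head G e)" if "e \<in> arcs G" "e \<noteq> e0" for e
      using P[rule_format, of e] that new by (auto simp: H_def split: if_splits)
    ultimately have "P (tail G e) = P (head G e)" if "e \<in> arcs G" for e using that by metis
    then have "P u = P (tail G e0)" if "u \<in> verts G" for u
      by (rule locally_constant_imp_constant[of P, OF _ that tail_in_verts[OF e0(1)]])
    then have "P u = P w" if "u \<in> verts H" for u
      using e0'(1) that by (cases "u = w") (simp_all add: H_def)
    then show "\<forall>u\<in>verts H. \<forall>v\<in>verts H. P u = P v" by metis
  qed
  then interpret H: metric_graph H len'
    by unfold_locales (use e0 new in \<open>auto simp: H_def len'_def len_pos\<close>)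
  have old: "\<phi> (edge_pt H len' e t) = edge_pt G len e t" if "e \<in> arcs G" "e \<noteq> e0" for e t
    using that new tail_ne by (auto simp: edge_pt_def H_def len'_def \<phi>_def)
  have lower: "\<phi> (edge_pt H len' e0 t) = edge_pt G len e0 t" if "t \<le> s0" for t
    using that e0 ne tail_ne by (auto simp: edge_pt_def H_def len'_def \<phi>_def)
  have upper: "\<phi> (edge_pt H len' a t) = edge_pt G len e0 (s0 + t)" if "0 \<le> t" for t
    using that e0 ne tail_ne by (auto simp: edge_pt_def H_def len'_def \<phi>_def)
  have "inj_on \<phi> (points H len')"
    using new e0 ne by (intro inj_onI) (auto simp: H.points_alt, auto simp: H_def \<phi>_def len'_def split: if_splits)
  moreover have "\<phi> ` points H len' = points G len"
  proof (intro equalityI subsetI)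
    fix x assume "x \<in> points G len"
    then consider v where "x = Vertex v" "v \<in> verts G"
      | e t where "x = Interior e t" "e \<in> arcs G" "0 < t" "t < len e" by (auto simp: points_alt)
    then show "x \<in> \<phi> ` points H len'"
    proof cases
      case 1
      then show ?thesis using new
        by (intro image_eqI[of _ _ "Vertex v"]) (auto simp: H.points_alt, auto simp: H_def \<phi>_def)
    next
      case 2
      consider "e \<noteq> e0" | "e = e0" "t \<le> s0" | "e = e0" "t > s0" by linarith
      then show ?thesis
      proof cases
        assume "e \<noteq> e0"
        then show ?thesis using 2 new old[of e t]
          by (intro image_eqI[OF _ H.edge_pt_in_points[of e t]]) (auto simp: H_def len'_def)
      next
        assume "e = e0" "t \<le> s0"
        then show ?thesis using 2 ne lower[of t]
          by (intro image_eqI[OF _ H.edge_pt_in_points[of e t]]) (auto simp: H_def len'_def)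
      next
        assume "e = e0" "t > s0"
        then show ?thesis using 2 ne upper[of "t - s0"]
          by (intro image_eqI[OF _ H.edge_pt_in_points[of a "t - s0"]]) (auto simp: H_def len'_def)
      qed
    qed
  qed (use new e0 in \<open>auto simp: points_alt H.points_alt, auto simp: H_def \<phi>_def len'_def split: if_splits\<close>)
  ultimately have bij: "bij_betw \<phi> (points H len') (points G len)"
    by (simp add: bij_betw_def)
  show ?thesis
    unfolding refines_def
  proof (intro conjI ballI allI impI)
    show "metric_graph G len" "metric_graph H len'" by unfold_locales
    fix e assume "e \<in> arcs H"
    then consider "e \<in> arcs G" "e \<noteq> e0" "e \<noteq> a" | "e = e0" | "e = a" using new by (auto simp: H_def)
    then show "\<exists>e'\<in>arcs G. \<exists>c\<ge>0. c + len' e \<le> len e' \<and> (\<forall>t\<ge>0. t \<le> len' e \<longrightarrow>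
        \<phi> (edge_pt H len' e t) = edge_pt G len e' (c + t))"
    proof cases
      case 1
      then show ?thesis using old by (intro bexI[of _ e] exI[of _ 0]) (auto simp: len'_def)
    next
      case 2
      then show ?thesis using lower e0 ne by (intro bexI[of _ e0] exI[of _ 0]) (auto simp: len'_def)
    next
      case 3
      then show ?thesis using upper e0 ne by (intro bexI[of _ e0] exI[of _ s0]) (auto simp: len'_def)
    qed
  next
    fix e s t x y
    assume e: "e \<in> arcs G" "0 \<le> s" "s \<le> t" "t \<le> len e" and xy: "x \<in> points H len'" "y \<in> points H len'"
      and eq: "\<phi> x = edge_pt G len e s" "\<phi> y = edge_pt G len e t"
    have eqI: "x' = y'" if "x' \<in> points H len'" "y' \<in> points H len'" "\<phi> x' = \<phi> y'" for x' y'
      using bij that by (auto simp: bij_betw_def dest: inj_onD)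
    have a: "a \<in> arcs H" "e0 \<in> arcs H" "e \<in> arcs H" "len' a = len e0 - s0" "len' e0 = s0"
      using e e0 ne by (auto simp: H_def len'_def)
    show "broken_path H len' x y (t - s)"
    proof (cases "e = e0")
      case False
      then have l: "len' e = len e" using e new by (auto simp: len'_def)
      have "x = edge_pt H len' e s" "y = edge_pt H len' e t"
        by (rule eqI[OF xy(1)] eqI[OF xy(2)],
            use e False a l old eq in \<open>simp_all add: H.edge_pt_in_points\<close>)+
      then show ?thesis using H.broken_path_segment[of e s t] e a l by simp
    next
      case True
      have lo: "z = edge_pt H len' e0 u" if "z \<in> points H len'" "\<phi> z = edge_pt G len e u" "0 \<le> u" "u \<le> s0" for z u
        by (rule eqI[OF that(1)]) (use that lower a e0 True in \<open>simp_all add: H.edge_pt_in_points\<close>)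
      have hi: "z = edge_pt H len' a (u - s0)" if "z \<in> points H len'" "\<phi> z = edge_pt G len e u" "s0 \<le> u" "u \<le> len e" for z u
        by (rule eqI[OF that(1)])
          (use that upper[of "u - s0"] a e0 True in \<open>simp_all add: H.edge_pt_in_points\<close>)
      consider "t \<le> s0" | "s0 \<le> s" | "s \<le> s0" "s0 \<le> t" by linarith
      then show ?thesis
      proof cases
        case 1
        then show ?thesis using lo[OF xy(1) eq(1)] lo[OF xy(2) eq(2)] e a H.broken_path_segment[of e0 s t] by simp
      next
        case 2
        then show ?thesis using hi[OF xy(1) eq(1)] hi[OF xy(2) eq(2)] e a True
            H.broken_path_segment[of a "s - s0" "t - s0"] by simp
      next
        case 3
        \<comment> \<open>A segment across s0 is cut at w, the end of \<open>e0\<close> and the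
          start of \<open>a\<close> in H.\<close>
        have "edge_pt H len' e0 s0 = edge_pt H len' a 0"
          using a e0 ne by (auto simp: edge_pt_def H_def)
        moreover have "broken_path H len' (edge_pt H len' e0 s) (edge_pt H len' e0 s0) (s0 - s)"
          using H.broken_path_segment[of e0 s s0] e a e0 3 by simp
        moreover have "broken_path H len' (edge_pt H len' a 0) (edge_pt H len' a (t - s0)) (t - s0)"
          using H.broken_path_segment[of a 0 "t - s0"] e a e0 3 True by simp
        ultimately have "broken_path H len' (edge_pt H len' e0 s) (edge_pt H len' a (t - s0)) ((s0 - s) + (t - s0))"
          using H.broken_path_trans by metis
        then show ?thesis using lo[OF xy(1) eq(1)] hi[OF xy(2) eq(2)] e 3 by simp
      qed
    qed
  qed (use bij in auto)
qed

text \<open>One subdivision for each point of B that is not yet a vertex; the relabelling by natural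
  numbers is the base case.\<close>

lemma exists_refinement:
  assumes "finite B" "B \<subseteq> points G len"
  shows "\<exists>(H :: (nat, nat) pre_digraph) len' \<phi>. refines G len H len' \<phi> \<and> B \<subseteq> \<phi> ` Vertex ` verts H"
  using assms
proof (induction B rule: finite_induct)
  case empty
  obtain \<alpha> :: "'v \<Rightarrow> nat" and \<beta> :: "'e \<Rightarrow> nat" where "inj_on \<alpha> (verts G)" "inj_on \<beta> (arcs G)"
    using finite_imp_inj_to_nat_seg finite_verts finite_arcs by metis
  from refines_relabel[OF this] show ?case by blast
next
  case (insert b B)
  then obtain H :: "(nat, nat) pre_digraph" and len' \<phi> where
    H: "refines G len H len' \<phi>" "B \<subseteq> \<phi> ` Vertex ` verts H" by auto
  interpret H: metric_graph H len' using H(1) by (rule refines_metric_graph')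
  obtain b' where b': "b' \<in> points H len'" "b = \<phi> b'"
    using refines_bij[OF H(1)] insert.prems unfolding bij_betw_def by blast
  show ?case
  proof (cases "b' \<in> Vertex ` verts H")
    case True
    then show ?thesis using H b' by (intro exI[of _ H] exI[of _ len'] exI[of _ \<phi>]) auto
  next
    case False
    with b' obtain e s where e: "b' = Interior e s" "e \<in> arcs H" "0 < s" "s < len' e"
      by (auto simp: H.points_alt)
    obtain w a where new: "w \<notin> verts H" "a \<notin> arcs H"
      using ex_new_if_finite[OF infinite_UNIV_nat] H.finite_verts H.finite_arcs by metis
    define H' where "H' = \<lparr>verts = insert w (verts H), arcs = insert a (arcs H),
      tail = (tail H)(a := w), head = (head H)(a := head H e, e := w)\<rparr>"
    define \<psi> where "\<psi> = (\<lambda>x. case x of Vertex v \<Rightarrow> if v = w then Interior e s else Vertex v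
      | Interior e' t \<Rightarrow> if e' = a then Interior e (s + t) else Interior e' t)"
    have "refines G len H' (len'(e := s, a := len' e - s)) (\<phi> \<circ> \<psi>)"
      using H.refines_subdivision[OF e(2-4) new] unfolding H'_def \<psi>_def by (rule refines_trans[OF H(1)])
    moreover have "insert b B \<subseteq> (\<phi> \<circ> \<psi>) ` Vertex ` verts H'"
    proof -
      have "\<phi> (Vertex v) = (\<phi> \<circ> \<psi>) (Vertex v)" if "v \<in> verts H" for v
        using that new by (auto simp: \<psi>_def)
      then have "B \<subseteq> (\<phi> \<circ> \<psi>) ` Vertex ` verts H'" using H(2) by (fastforce simp: H'_def)
      moreover have "b = (\<phi> \<circ> \<psi>) (Vertex w)" using b' e by (simp add: \<psi>_def)
      ultimately show ?thesis by (auto simp: H'_def)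
    qed
    ultimately show ?thesis by blast
  qed
qed

end


section \<open>Piecewise linear functions\<close>

text \<open>Equality near the point instead of a one-sided derivative: the limit in
  \<open>outgoing_slope\<close> alone would not make f affine on a short segment.\<close>

definition has_slope ::
    "('v, 'e) pre_digraph \<Rightarrow> ('e \<Rightarrow> real) \<Rightarrow> (('v, 'e) point \<Rightarrow> real) \<Rightarrow> 'e \<times> real \<times> real \<Rightarrow> int \<Rightarrow> bool" where
  "has_slope G len f = (\<lambda>(e, t, s) a. \<forall>\<^sub>F h in at_right 0.
     f (edge_pt G len e (t + s * h)) = f (edge_pt G len e t) + of_int a * h)"

definition locally_linear ::
    "('v, 'e) pre_digraph \<Rightarrow> ('e \<Rightarrow> real) \<Rightarrow> (('v, 'e) point \<Rightarrow> real) \<Rightarrow> bool" where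
  "locally_linear G len f \<longleftrightarrow> (\<forall>x. \<forall>\<delta>\<in>directions G len x. \<exists>a. has_slope G len f \<delta> a)"

lemma outgoing_slope_eq:
  assumes "has_slope G len f \<delta> a"
  shows "outgoing_slope G len f \<delta> = of_int a"
proof -
  obtain e t s where \<delta>: "\<delta> = (e, t, s)" by (cases \<delta>)
  have "\<forall>\<^sub>F h in at_right 0. (f (edge_pt G len e (t + s * h)) - f (edge_pt G len e t)) / h = of_int a"
    using assms eventually_at_right_less[of "0::real"] unfolding has_slope_def \<delta> prod.case
    by eventually_elim simp
  then have "((\<lambda>h. (f (edge_pt G len e (t + s * h)) - f (edge_pt G len e t)) / h) \<longlongrightarrow> of_int a) (at_right 0)"
    by (rule tendsto_eventually)
  then show ?thesis by (simp add: outgoing_slope_def \<delta> tendsto_Lim)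
qed

text \<open>The distance travelled from t is \<open>s * (u - t)\<close>, so both orientations are
  treated at once. Passing the slope on to nearby points is what makes bends isolated.\<close>

lemma has_slope_near:
  assumes "has_slope G len f (e, t, s) a" "s = 1 \<or> s = -1"
  obtains d where "0 < d"
    "\<And>u. 0 < s * (u - t) \<Longrightarrow> s * (u - t) < d \<Longrightarrow>
       f (edge_pt G len e u) = f (edge_pt G len e t) + of_int a * (s * (u - t))"
    "\<And>u. 0 < s * (u - t) \<Longrightarrow> s * (u - t) < d \<Longrightarrow>
       has_slope G len f (e, u, s) a \<and> has_slope G len f (e, u, -s) (-a)"
proof -
  obtain d where d: "0 < d"
    "\<And>h. 0 < h \<Longrightarrow> h < d \<Longrightarrow> f (edge_pt G len e (t + s * h)) = f (edge_pt G len e t) + of_int a * h"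
    using assms(1) unfolding has_slope_def prod.case eventually_at_right_field by auto
  have f: "f (edge_pt G len e u) = f (edge_pt G len e t) + of_int a * (s * (u - t))"
    if "0 < s * (u - t)" "s * (u - t) < d" for u
    using d(2)[OF that] assms(2) by (auto simp: algebra_simps)
  show thesis
  proof (rule that[OF d(1) f])
    fix u assume u: "0 < s * (u - t)" "s * (u - t) < d"
    have 1: "\<forall>\<^sub>F h in at_right 0. 0 < h \<and> h < min (s * (u - t)) (d - s * (u - t))"
      using u by (auto intro!: eventually_conj eventually_at_right_less
          order_tendstoD(2)[OF tendsto_ident_at])
    have 2: "f (edge_pt G len e (u + s * h)) = f (edge_pt G len e u) + of_int a * h \<and>
        f (edge_pt G len e (u + (- s) * h)) = f (edge_pt G len e u) + of_int (- a) * h"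
      if h: "0 < h \<and> h < min (s * (u - t)) (d - s * (u - t))" for h
    proof -
      have eq: "s * (u + s * h - t) = s * (u - t) + h" "s * (u + (- s) * h - t) = s * (u - t) - h"
        using assms(2) by (auto simp: algebra_simps)
      show ?thesis
        using f[OF u] f[of "u + s * h"] f[of "u + (- s) * h"] h u unfolding eq
        by (simp add: algebra_simps)
    qed
    have "has_slope G len f (e, u, s) a"
      unfolding has_slope_def prod.case using 1 by (rule eventually_mono) (use 2 in blast)
    moreover have "has_slope G len f (e, u, - s) (- a)"
      unfolding has_slope_def prod.case using 1 by (rule eventually_mono) (use 2 in blast)
    ultimately show "has_slope G len f (e, u, s) a \<and> has_slope G len f (e, u, - s) (- a)" by simp
  qed auto
qed

lemma has_slope_near_right:
  assumes "has_slope G len f (e, t, 1) a"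
  obtains d where "0 < d"
    "\<And>u. t < u \<Longrightarrow> u < t + d \<Longrightarrow> f (edge_pt G len e u) = f (edge_pt G len e t) + of_int a * (u - t) \<and>
       has_slope G len f (e, u, 1) a \<and> has_slope G len f (e, u, -1) (-a)"
proof -
  obtain d where d: "0 < d"
    "\<And>u. 0 < 1 * (u - t) \<Longrightarrow> 1 * (u - t) < d \<Longrightarrow>
       f (edge_pt G len e u) = f (edge_pt G len e t) + of_int a * (1 * (u - t))"
    "\<And>u. 0 < 1 * (u - t) \<Longrightarrow> 1 * (u - t) < d \<Longrightarrow>
       has_slope G len f (e, u, 1) a \<and> has_slope G len f (e, u, -1) (-a)"
    by (rule has_slope_near[OF assms]) auto
  show thesis by (rule that[OF d(1)]) (use d(2,3) in auto)
qed

lemma has_slope_near_left: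
  assumes "has_slope G len f (e, t, -1) a"
  obtains d where "0 < d"
    "\<And>u. t - d < u \<Longrightarrow> u < t \<Longrightarrow> f (edge_pt G len e u) = f (edge_pt G len e t) + of_int a * (t - u) \<and>
       has_slope G len f (e, u, 1) (-a) \<and> has_slope G len f (e, u, -1) a"
proof -
  obtain d where d: "0 < d"
    "\<And>u. 0 < -1 * (u - t) \<Longrightarrow> -1 * (u - t) < d \<Longrightarrow>
       f (edge_pt G len e u) = f (edge_pt G len e t) + of_int a * (-1 * (u - t))"
    "\<And>u. 0 < -1 * (u - t) \<Longrightarrow> -1 * (u - t) < d \<Longrightarrow>
       has_slope G len f (e, u, -1) a \<and> has_slope G len f (e, u, - (-1)) (-a)"
    by (rule has_slope_near[OF assms]) auto
  show thesis by (rule that[OF d(1)]) (use d(2,3) in auto)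
qed

lemma has_slope_add:
  assumes "has_slope G len f \<delta> a" "has_slope G len g \<delta> b"
  shows "has_slope G len (\<lambda>x. f x + g x) \<delta> (a + b)"
proof -
  obtain e t s where \<delta>: "\<delta> = (e, t, s)" by (cases \<delta>)
  show ?thesis
    using assms unfolding has_slope_def \<delta> prod.case
    by eventually_elim (simp add: algebra_simps)
qed

lemma has_slope_uminus:
  assumes "has_slope G len f \<delta> a"
  shows "has_slope G len (\<lambda>x. - f x) \<delta> (- a)"
proof -
  obtain e t s where \<delta>: "\<delta> = (e, t, s)" by (cases \<delta>)
  show ?thesis
    using assms unfolding has_slope_def \<delta> prod.case
    by eventually_elim (simp add: algebra_simps)
qed

lemma locally_linear_add:
  "locally_linear G len f \<Longrightarrow> locally_linear G len g \<Longrightarrow> locally_linear G len (\<lambda>x. f x + g x)"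
  unfolding locally_linear_def using has_slope_add by blast

lemma locally_linear_uminus:
  "locally_linear G len f \<Longrightarrow> locally_linear G len (\<lambda>x. - f x)"
  unfolding locally_linear_def using has_slope_uminus by blast

section \<open>Bends, and \<open>PL_Z\<close> without models\<close>

context metric_graph
begin

lemma locally_linear_has_slope:
  assumes "locally_linear G len f" "e \<in> arcs G" "0 \<le> t" "t \<le> len e"
  shows "t < len e \<Longrightarrow> \<exists>a. has_slope G len f (e, t, 1) a"
    and "0 < t \<Longrightarrow> \<exists>a. has_slope G len f (e, t, -1) a"
  using assms unfolding locally_linear_def directions_def by auto

text \<open>Both slopes are measured outwards, so their sum vanishes exactly when the slope passes
  through t unchanged.\<close>

definition bend :: "(('v, 'e) point \<Rightarrow> real) \<Rightarrow> 'e \<Rightarrow> real \<Rightarrow> real" where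
  "bend f e t = outgoing_slope G len f (e, t, 1) + outgoing_slope G len f (e, t, -1)"

lemma bend_eq_0_near:
  assumes "locally_linear G len f" "e \<in> arcs G" "0 \<le> t" "t \<le> len e"
  shows "\<exists>d>0. \<forall>u. u \<noteq> t \<longrightarrow> 0 < u \<longrightarrow> u < len e \<longrightarrow> \<bar>u - t\<bar> < d \<longrightarrow> bend f e u = 0"
proof -
  have right: "\<exists>d>0. \<forall>u. t < u \<longrightarrow> u < len e \<longrightarrow> u - t < d \<longrightarrow> bend f e u = 0"
  proof (cases "t < len e")
    case True
    then obtain a where "has_slope G len f (e, t, 1) a" using locally_linear_has_slope assms by blast
    then obtain d where d: "0 < d" "\<And>u. t < u \<Longrightarrow> u < t + d \<Longrightarrow>
        f (edge_pt G len e u) = f (edge_pt G len e t) + of_int a * (u - t) \<and>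
        has_slope G len f (e, u, 1) a \<and> has_slope G len f (e, u, -1) (-a)"
      by (rule has_slope_near_right) blast
    have "bend f e u = 0" if "t < u" "u < t + d" for u
      using d(2)[OF that] by (auto simp: bend_def dest!: outgoing_slope_eq)
    then show ?thesis using d(1) by (intro exI[of _ d]) auto
  qed (auto intro: exI[of _ 1])
  have left: "\<exists>d>0. \<forall>u. u < t \<longrightarrow> 0 < u \<longrightarrow> t - u < d \<longrightarrow> bend f e u = 0"
  proof (cases "0 < t")
    case True
    then obtain a where "has_slope G len f (e, t, -1) a" using locally_linear_has_slope assms by blast
    then obtain d where d: "0 < d" "\<And>u. t - d < u \<Longrightarrow> u < t \<Longrightarrow>
        f (edge_pt G len e u) = f (edge_pt G len e t) + of_int a * (t - u) \<and>
        has_slope G len f (e, u, 1) (-a) \<and> has_slope G len f (e, u, -1) a"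
      by (rule has_slope_near_left) blast
    have "bend f e u = 0" if "t - d < u" "u < t" for u
      using d(2)[OF that] by (auto simp: bend_def dest!: outgoing_slope_eq)
    then show ?thesis using d(1) by (intro exI[of _ d]) auto
  qed (auto intro: exI[of _ 1])
  from left right obtain d d' where "0 < d" "0 < d'"
    "\<And>u. u < t \<Longrightarrow> 0 < u \<Longrightarrow> t - u < d \<Longrightarrow> bend f e u = 0"
    "\<And>u. t < u \<Longrightarrow> u < len e \<Longrightarrow> u - t < d' \<Longrightarrow> bend f e u = 0" by blast
  then show ?thesis by (intro exI[of _ "min d d'"]) (auto simp: abs_if split: if_splits)
qed

text \<open>Every parameter, end points included, has a punctured neighbourhood without bends, so an
  accumulation point of bends in the compact edge is impossible.\<close>

lemma finite_bends:
  assumes "locally_linear G len f" "e \<in> arcs G"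
  shows "finite {t. 0 < t \<and> t < len e \<and> bend f e t \<noteq> 0}" (is "finite ?S")
proof (rule ccontr)
  assume inf: "infinite ?S"
  have "?S \<subseteq> {0..len e}" by auto
  then obtain t where t: "t \<in> {0..len e}" "t islimpt ?S"
    using Heine_Borel_imp_Bolzano_Weierstrass[OF compact_Icc inf] by blast
  then obtain d where "0 < d" "\<And>u. u \<noteq> t \<Longrightarrow> 0 < u \<Longrightarrow> u < len e \<Longrightarrow> \<bar>u - t\<bar> < d \<Longrightarrow> bend f e u = 0"
    using bend_eq_0_near[of f e t] assms by auto
  with t(2) show False unfolding islimpt_approachable dist_real_def by blast
qed

text \<open>Local constancy on a connected set, used twice: for the slope on the open interval, then
  for f minus a linear function on the closed one. The end points come in because
  \<open>has_slope\<close> compares nearby values with the value at the point itself.\<close>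

lemma linear_between_bends:
  assumes f: "locally_linear G len f" and e: "e \<in> arcs G" "0 \<le> \<alpha>" "\<alpha> < \<beta>" "\<beta> \<le> len e"
    and bend: "\<And>t. \<alpha> < t \<Longrightarrow> t < \<beta> \<Longrightarrow> bend f e t = 0"
  shows "\<exists>a :: int.
    (\<forall>t. \<alpha> \<le> t \<longrightarrow> t \<le> \<beta> \<longrightarrow> f (edge_pt G len e t) = f (edge_pt G len e \<alpha>) + of_int a * (t - \<alpha>)) \<and>
    has_slope G len f (e, \<alpha>, 1) a \<and> has_slope G len f (e, \<beta>, -1) (-a)"
proof -
  define \<sigma> where "\<sigma> t = outgoing_slope G len f (e, t, 1)" for t
  have local: "\<exists>d>0. \<forall>u. \<bar>u - t\<bar> < d \<longrightarrow> \<sigma> u = \<sigma> t \<and>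
      f (edge_pt G len e u) = f (edge_pt G len e t) + \<sigma> t * (u - t)"
    if t: "\<alpha> < t" "t < \<beta>" for t
  proof -
    obtain a b where ab: "has_slope G len f (e, t, 1) a" "has_slope G len f (e, t, -1) b"
      using locally_linear_has_slope[of f e t] f e t by force
    have \<sigma>: "\<sigma> t = of_int a" "b = - a"
      using ab[THEN outgoing_slope_eq] bend[OF t] by (auto simp: \<sigma>_def bend_def)
    obtain d where d: "0 < d" "\<And>u. t < u \<Longrightarrow> u < t + d \<Longrightarrow>
        f (edge_pt G len e u) = f (edge_pt G len e t) + of_int a * (u - t) \<and>
        has_slope G len f (e, u, 1) a \<and> has_slope G len f (e, u, -1) (-a)"
      using ab(1) by (rule has_slope_near_right) blast
    obtain d' where d': "0 < d'" "\<And>u. t - d' < u \<Longrightarrow> u < t \<Longrightarrow>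
        f (edge_pt G len e u) = f (edge_pt G len e t) + of_int b * (t - u) \<and>
        has_slope G len f (e, u, 1) (-b) \<and> has_slope G len f (e, u, -1) b"
      using ab(2) by (rule has_slope_near_left) blast
    have "\<sigma> u = \<sigma> t \<and> f (edge_pt G len e u) = f (edge_pt G len e t) + \<sigma> t * (u - t)"
      if u: "\<bar>u - t\<bar> < min d d'" for u
    proof (cases u t rule: linorder_cases)
      case less
      then have "f (edge_pt G len e u) = f (edge_pt G len e t) + of_int b * (t - u)"
        "has_slope G len f (e, u, 1) (-b)"
        using d'(2)[of u] u by auto
      from this(1) outgoing_slope_eq[OF this(2)] show ?thesis
        unfolding \<sigma> unfolding \<sigma>_def by (simp add: algebra_simps)
    next
      case greater
      then have "f (edge_pt G len e u) = f (edge_pt G len e t) + of_int a * (u - t)"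
        "has_slope G len f (e, u, 1) a"
        using d(2)[of u] u by auto
      from this(1) outgoing_slope_eq[OF this(2)] show ?thesis
        unfolding \<sigma> unfolding \<sigma>_def by (simp add: algebra_simps)
    qed simp
    moreover have "0 < min d d'" using d(1) d'(1) by simp
    ultimately show ?thesis by blast
  qed
  define m where "m = (\<alpha> + \<beta>) / 2"
  have m: "\<alpha> < m" "m < \<beta>" using e by (auto simp: m_def)
  obtain a where a: "has_slope G len f (e, m, 1) a"
    using locally_linear_has_slope(1)[of f e m] f e m by force
  have \<sigma>_const: "\<sigma> t = of_int a" if t: "\<alpha> < t" "t < \<beta>" for t
  proof -
    have "\<sigma> t = \<sigma> m"
    proof (rule connected_local_const[of "{\<alpha><..<\<beta>}" t m \<sigma>])
      show "\<forall>x\<in>{\<alpha><..<\<beta>}. \<forall>\<^sub>F y in at x within {\<alpha><..<\<beta>}. \<sigma> x = \<sigma> y"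
      proof
        fix x assume "x \<in> {\<alpha><..<\<beta>}"
        then obtain d where d: "0 < d" "\<And>u. \<bar>u - x\<bar> < d \<Longrightarrow> \<sigma> u = \<sigma> x" using local[of x] by auto
        have "\<sigma> x = \<sigma> y" if "dist y x < d" for y using d(2)[of y] that by (simp add: dist_real_def)
        with d(1) show "\<forall>\<^sub>F y in at x within {\<alpha><..<\<beta>}. \<sigma> x = \<sigma> y" unfolding eventually_at by blast
      qed
    qed (use t m in auto)
    then show ?thesis using outgoing_slope_eq[OF a] by (simp add: \<sigma>_def)
  qed
  have end\<alpha>: "has_slope G len f (e, \<alpha>, 1) a"
  proof -
    obtain b where b: "has_slope G len f (e, \<alpha>, 1) b"
      using locally_linear_has_slope(1)[of f e \<alpha>] f e by force
    then obtain d where d: "0 < d" "\<And>u. \<alpha> < u \<Longrightarrow> u < \<alpha> + d \<Longrightarrow>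
        f (edge_pt G len e u) = f (edge_pt G len e \<alpha>) + of_int b * (u - \<alpha>) \<and>
        has_slope G len f (e, u, 1) b \<and> has_slope G len f (e, u, -1) (-b)"
      by (rule has_slope_near_right) blast
    define u where "u = \<alpha> + min d (\<beta> - \<alpha>) / 2"
    have u: "\<alpha> < u" "u < \<beta>" "u - \<alpha> < d" using d e by (auto simp: u_def min_def field_simps)
    then have "has_slope G len f (e, u, 1) b" using d(2)[of u] by simp
    from outgoing_slope_eq[OF this] \<sigma>_const[OF u(1,2)] have "a = b" by (simp add: \<sigma>_def)
    with b show ?thesis by simp
  qed
  have end\<beta>: "has_slope G len f (e, \<beta>, -1) (-a)"
  proof -
    obtain b where b: "has_slope G len f (e, \<beta>, -1) b"
      using locally_linear_has_slope(2)[of f e \<beta>] f e by force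
    then obtain d where d: "0 < d" "\<And>u. \<beta> - d < u \<Longrightarrow> u < \<beta> \<Longrightarrow>
        f (edge_pt G len e u) = f (edge_pt G len e \<beta>) + of_int b * (\<beta> - u) \<and>
        has_slope G len f (e, u, 1) (-b) \<and> has_slope G len f (e, u, -1) b"
      by (rule has_slope_near_left) blast
    define u where "u = \<beta> - min d (\<beta> - \<alpha>) / 2"
    have u: "\<alpha> < u" "u < \<beta>" "\<beta> - u < d" using d e by (auto simp: u_def min_def field_simps)
    then have "has_slope G len f (e, u, 1) (-b)" using d(2)[of u] by simp
    from outgoing_slope_eq[OF this] \<sigma>_const[OF u(1,2)] have "a = - b" by (simp add: \<sigma>_def)
    with b show ?thesis by simp
  qed
  define k where "k t = f (edge_pt G len e t) - of_int a * t" for t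
  have "\<forall>t\<in>{\<alpha>..\<beta>}. \<forall>\<^sub>F u in at t within {\<alpha>..\<beta>}. k t = k u"
  proof
    fix t assume t: "t \<in> {\<alpha>..\<beta>}"
    then consider "t = \<alpha>" | "t = \<beta>" | "\<alpha> < t" "t < \<beta>" by force
    then show "\<forall>\<^sub>F u in at t within {\<alpha>..\<beta>}. k t = k u"
    proof cases
      case 1
      obtain d where d: "0 < d" "\<And>u. \<alpha> < u \<Longrightarrow> u < \<alpha> + d \<Longrightarrow>
          f (edge_pt G len e u) = f (edge_pt G len e \<alpha>) + of_int a * (u - \<alpha>) \<and>
          has_slope G len f (e, u, 1) a \<and> has_slope G len f (e, u, -1) (-a)"
        using end\<alpha> by (rule has_slope_near_right) blast
      have "k t = k u" if "u \<in> {\<alpha>..\<beta>}" "u \<noteq> t" "dist u t < d" for u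
        using d(2)[of u] that 1 by (simp add: k_def dist_real_def algebra_simps)
      with d(1) show ?thesis unfolding eventually_at by blast
    next
      case 2
      obtain d where d: "0 < d" "\<And>u. \<beta> - d < u \<Longrightarrow> u < \<beta> \<Longrightarrow>
          f (edge_pt G len e u) = f (edge_pt G len e \<beta>) + of_int (-a) * (\<beta> - u) \<and>
          has_slope G len f (e, u, 1) (-(-a)) \<and> has_slope G len f (e, u, -1) (-a)"
        using end\<beta> by (rule has_slope_near_left) blast
      have "k t = k u" if "u \<in> {\<alpha>..\<beta>}" "u \<noteq> t" "dist u t < d" for u
        using d(2)[of u] that 2 by (simp add: k_def dist_real_def algebra_simps)
      with d(1) show ?thesis unfolding eventually_at by blast
    next
      case 3
      obtain d where d: "0 < d" "\<And>u. \<bar>u - t\<bar> < d \<Longrightarrow> f (edge_pt G len e u) = f (edge_pt G len e t) + \<sigma> t * (u - t)"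
        using local[OF 3] by blast
      have "k t = k u" if "dist u t < d" for u
        using d(2)[of u] that \<sigma>_const[OF 3] by (simp add: k_def dist_real_def algebra_simps)
      with d(1) show ?thesis unfolding eventually_at by blast
    qed
  qed
  then have "k t = k \<alpha>" if "\<alpha> \<le> t" "t \<le> \<beta>" for t
    using connected_local_const[of "{\<alpha>..\<beta>}" t \<alpha> k] that e by auto
  then have "f (edge_pt G len e t) = f (edge_pt G len e \<alpha>) + of_int a * (t - \<alpha>)"
    if "\<alpha> \<le> t" "t \<le> \<beta>" for t
    using that by (simp add: k_def algebra_simps)
  with end\<alpha> end\<beta> show ?thesis by blast
qed

text \<open>The points near p lie on the finitely many legs of a star, and f tends to f p along each
  of them.\<close>

lemma locally_linear_continuous:
  assumes f: "locally_linear G len f"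
  shows "continuous_map (graph_topology G len) euclideanreal f"
  unfolding Metric_space.continuous_map_from_metric[OF Metric_space_path_dist]
proof (intro conjI ballI allI impI)
  fix p U assume p: "p \<in> points G len" and U: "openin euclideanreal U \<and> f p \<in> U"
  then obtain \<eta> where \<eta>: "0 < \<eta>" "ball (f p) \<eta> \<subseteq> U"
    by (metis open_contains_ball open_openin)
  obtain \<epsilon> where \<epsilon>: "0 < \<epsilon>"
    "\<And>z. z \<in> points G len \<Longrightarrow> z \<noteq> p \<Longrightarrow> path_dist G len p z < \<epsilon> \<Longrightarrow>
      \<exists>(e, t, s)\<in>directions G len p. z = edge_pt G len e (t + s * path_dist G len p z)"
    by (rule star_neighbourhood[OF p]) blast
  have "\<forall>\<^sub>F h in at_right 0. \<forall>(e, t, s)\<in>directions G len p. f (edge_pt G len e (t + s * h)) \<in> ball (f p) \<eta>"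
  proof (intro eventually_ball_finite finite_directions p ballI)
    fix \<delta> assume \<delta>: "\<delta> \<in> directions G len p"
    obtain e t s where \<delta>': "\<delta> = (e, t, s)" by (cases \<delta>)
    obtain a where a: "has_slope G len f (e, t, s) a"
      using f \<delta> unfolding locally_linear_def \<delta>' by blast
    have "((\<lambda>h. f p + of_int a * h) \<longlongrightarrow> f p + of_int a * 0) (at_right 0)"
      by (intro tendsto_intros)
    then have "\<forall>\<^sub>F h in at_right 0. f p + of_int a * h \<in> ball (f p) \<eta>"
      using \<eta>(1) by (intro topological_tendstoD) auto
    with a show "\<forall>\<^sub>F h in at_right 0. case \<delta> of (e, t, s) \<Rightarrow> f (edge_pt G len e (t + s * h)) \<in> ball (f p) \<eta>"
      unfolding has_slope_def \<delta>' prod.case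
      by eventually_elim (use \<delta> in \<open>auto simp: \<delta>' directions_def\<close>)
  qed
  then obtain d where d: "0 < d" "\<And>h. 0 < h \<Longrightarrow> h < d \<Longrightarrow>
      \<forall>(e, t, s)\<in>directions G len p. f (edge_pt G len e (t + s * h)) \<in> ball (f p) \<eta>"
    unfolding eventually_at_right_field by auto
  have "f z \<in> U" if z: "z \<in> points G len" "path_dist G len p z < min \<epsilon> d" for z
  proof (cases "z = p")
    case False
    then have "0 < path_dist G len p z"
      using Metric_space.mdist_pos_eq[OF Metric_space_path_dist] p z by simp
    with \<epsilon>(2)[OF z(1) False] d(2)[of "path_dist G len p z"] z(2) \<eta>(2) show ?thesis
      by fastforce
  qed (use U in auto)
  then show "\<exists>r>0. \<forall>x. x \<in> points G len \<and> path_dist G len p x < r \<longrightarrow> f x \<in> U"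
    using \<epsilon>(1) d(1) by (intro exI[of _ "min \<epsilon> d"]) auto
qed simp

text \<open>Subdividing at the finitely many bends gives a model on whose edges f is linear.\<close>

lemma locally_linear_imp_PL_Z:
  assumes f: "locally_linear G len f"
  shows "f \<in> PL_Z G len"
proof -
  define B :: "('v, 'e) point set" where "B = (\<Union>e\<in>arcs G. Interior e ` {t. 0 < t \<and> t < len e \<and> bend f e t \<noteq> 0})"
  have B: "finite B" "B \<subseteq> points G len"
    using finite_bends[OF f] by (auto simp: B_def points_alt)
  then obtain H :: "(nat, nat) pre_digraph" and len' \<phi> where
    H: "refines G len H len' \<phi>" "B \<subseteq> \<phi> ` Vertex ` verts H"
    using exists_refinement[OF B] by blast
  interpret H: metric_graph H len' using H(1) by (rule refines_metric_graph')
  have "\<exists>(a :: int) b. \<forall>t. 0 \<le> t \<and> t \<le> len' e' \<longrightarrow> f (\<phi> (edge_pt H len' e' t)) = of_int a * t + b"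
    if e': "e' \<in> arcs H" for e'
  proof -
    obtain e c where e: "e \<in> arcs G" "0 \<le> c" "c + len' e' \<le> len e"
      "\<And>t. 0 \<le> t \<Longrightarrow> t \<le> len' e' \<Longrightarrow> \<phi> (edge_pt H len' e' t) = edge_pt G len e (c + t)"
      using H(1) e' unfolding refines_def by meson
    \<comment> \<open>A bend inside an edge of H would also be the image of a vertex of H, against
      the injectivity of \<phi>.\<close>
    have bend0: "bend f e t = 0" if t: "c < t" "t < c + len' e'" for t
    proof (rule ccontr)
      assume "bend f e t \<noteq> 0"
      then have "Interior e t \<in> Interior e ` {t. 0 < t \<and> t < len e \<and> bend f e t \<noteq> 0}"
        using t e(2,3) by (intro imageI) simp
      then have "Interior e t \<in> B" unfolding B_def by (rule UN_I[OF e(1)])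
      then obtain v where v: "v \<in> verts H" "\<phi> (Vertex v) = Interior e t" using H(2) by auto
      have "\<phi> (edge_pt H len' e' (t - c)) = \<phi> (Vertex v)" using e(4)[of "t - c"] t e(2,3) v(2) by simp
      moreover have "edge_pt H len' e' (t - c) \<in> points H len'"
        using t e' by (intro H.edge_pt_in_points) auto
      moreover have "Vertex v \<in> points H len'" using v(1) by (simp add: points_def)
      ultimately have "edge_pt H len' e' (t - c) = Vertex v"
        by (rule inj_onD[OF bij_betw_imp_inj_on[OF refines_bij[OF H(1)]]])
      then show False using t by (simp add: edge_pt_def)
    qed
    have "c < c + len' e'" using H.len_pos[OF e'] by simp
    from linear_between_bends[OF f e(1,2) this e(3) bend0] obtain a :: int where a: "\<And>t. c \<le> t \<Longrightarrow> t \<le> c + len' e' \<Longrightarrow>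
        f (edge_pt G len e t) = f (edge_pt G len e c) + of_int a * (t - c)"
      by blast
    have "f (\<phi> (edge_pt H len' e' t)) = of_int a * t + f (edge_pt G len e c)"
      if "0 \<le> t" "t \<le> len' e'" for t
      using e(4)[OF that] a[of "c + t"] that by simp
    then show ?thesis by blast
  qed
  then show ?thesis
    using refines_is_model[OF H(1)] locally_linear_continuous[OF f] unfolding PL_Z_def by blast
qed

text \<open>A short segment leaving p is geodesic, so its preimage in the model moves away from the
  preimage of p at unit speed. It stays on a single leg of the star there, where f is linear with
  integer slope.\<close>

lemma PL_Z_imp_locally_linear:
  assumes "f \<in> PL_Z G len"
  shows "locally_linear G len f"
  unfolding locally_linear_def
proof (intro allI ballI)
  fix p \<delta> assume \<delta>: "\<delta> \<in> directions G len p"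
  obtain e t s where \<delta>': "\<delta> = (e, t, s)" by (cases \<delta>)
  have e: "e \<in> arcs G" "0 \<le> t" "t \<le> len e" "p = edge_pt G len e t" "s = 1 \<or> s = -1"
    "s = 1 \<Longrightarrow> t < len e" "s = -1 \<Longrightarrow> 0 < t"
    using \<delta> by (auto simp: \<delta>' directions_def)
  obtain H :: "(nat, nat) pre_digraph" and len' \<phi> where
    H: "is_model (points G len) (path_dist G len) H len' \<phi>"
    "\<And>e. e \<in> arcs H \<Longrightarrow> \<exists>(a :: int) b. \<forall>t. 0 \<le> t \<and> t \<le> len' e \<longrightarrow> f (\<phi> (edge_pt H len' e t)) = of_int a * t + b"
    using assms unfolding PL_Z_def by blast
  interpret H: metric_graph H len' using H(1) unfolding is_model_def by blast
  have bij: "bij_betw \<phi> (points H len') (points G len)"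
    and iso: "\<And>x y. x \<in> points H len' \<Longrightarrow> y \<in> points H len' \<Longrightarrow>
      path_dist G len (\<phi> x) (\<phi> y) = path_dist H len' x y"
    using H(1) unfolding is_model_def by blast+
  have surj: "\<exists>x'\<in>points H len'. \<phi> x' = x" if "x \<in> points G len" for x
    using bij_betw_imp_surj_on[OF bij] that by (metis imageE)
  obtain p' where p': "p' \<in> points H len'" "\<phi> p' = p"
    using surj[of p] e edge_pt_in_points by blast
  obtain \<epsilon> where \<epsilon>: "0 < \<epsilon>"
    "\<And>z. z \<in> points H len' \<Longrightarrow> z \<noteq> p' \<Longrightarrow> path_dist H len' p' z < \<epsilon> \<Longrightarrow>
      \<exists>(e, t, s)\<in>directions H len' p'. z = edge_pt H len' e (t + s * path_dist H len' p' z)"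
    "\<And>e t s r. (e, t, s) \<in> directions H len' p' \<Longrightarrow> 0 \<le> r \<Longrightarrow> r < \<epsilon> \<Longrightarrow> 0 \<le> t + s * r \<and> t + s * r \<le> len' e"
    "\<And>e t s r e' t' s' r'. (e, t, s) \<in> directions H len' p' \<Longrightarrow> (e', t', s') \<in> directions H len' p' \<Longrightarrow>
      (e, t, s) \<noteq> (e', t', s') \<Longrightarrow> 0 < r \<Longrightarrow> 2 * r < \<epsilon> \<Longrightarrow> 0 < r' \<Longrightarrow> 2 * r' < \<epsilon> \<Longrightarrow>
      r \<le> path_dist H len' (edge_pt H len' e (t + s * r)) (edge_pt H len' e' (t' + s' * r'))"
    by (rule H.star_neighbourhood[OF p'(1)]) blast
  \<comment> \<open>\<epsilon> / 2 is the range in which different legs are apart,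
    \<open>len e / 2\<close> keeps the segment geodesic, and the last bound keeps it on the
    edge.\<close>
  define d where "d = min (\<epsilon> / 2) (min (len e / 2) (if s = 1 then len e - t else t))"
  have d: "0 < d" "2 * d \<le> \<epsilon>" "d \<le> len e / 2" "\<And>h. 0 \<le> h \<Longrightarrow> h < d \<Longrightarrow> 0 \<le> t + s * h \<and> t + s * h \<le> len e"
    using e len_pos[OF e(1)] \<epsilon>(1) by (auto simp: d_def min_def split: if_splits)
  define z where "z h = edge_pt G len e (t + s * h)" for h
  have z_in: "z h \<in> points G len" if "0 \<le> h" "h < d" for h
    using d(4)[OF that] e(1) by (simp add: z_def edge_pt_in_points)
  have z_dist: "path_dist G len (z h) (z h') = \<bar>h' - h\<bar>" if "0 \<le> h" "h < d" "0 \<le> h'" "h' < d" for h h'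
  proof -
    have "\<bar>(t + s * h') - (t + s * h)\<bar> = \<bar>h' - h\<bar>" using e(5) by auto
    moreover have "\<bar>h' - h\<bar> \<le> len e / 2" using that d(3) by linarith
    ultimately show ?thesis
      using path_dist_short_segment[of e "t + s * h" "t + s * h'"] d(4) that e(1) by (simp add: z_def)
  qed
  have z0: "z 0 = p" using e by (simp add: z_def)
  have dir: "\<exists>(e', t', s')\<in>directions H len' p'. edge_pt H len' e' (t' + s' * h) \<in> points H len' \<and>
      \<phi> (edge_pt H len' e' (t' + s' * h)) = z h" if h: "0 < h" "h < d" for h
  proof -
    obtain w where w: "w \<in> points H len'" "\<phi> w = z h" using surj[of "z h"] z_in[of h] h by auto
    have dw: "path_dist H len' p' w = h"
      using iso[OF p'(1) w(1)] z_dist[of 0 h] h z0 p' w by simp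
    moreover have "w \<noteq> p'" using dw H.Metric_space_path_dist p'(1) h
      by (auto simp: Metric_space.mdist_zero)
    ultimately obtain e' t' s' where "(e', t', s') \<in> directions H len' p'" "w = edge_pt H len' e' (t' + s' * h)"
      using \<epsilon>(2)[OF w(1)] h d(2) by fastforce
    then show ?thesis using w by auto
  qed
  \<comment> \<open>The leg found at distance d / 2 is the reference with which the legs at all
    other distances h are compared.\<close>
  obtain e' t' s' where dir0: "(e', t', s') \<in> directions H len' p'"
    "edge_pt H len' e' (t' + s' * (d / 2)) \<in> points H len'" "\<phi> (edge_pt H len' e' (t' + s' * (d / 2))) = z (d / 2)"
    using dir[of "d / 2"] d(1) by auto
  have dir': "\<phi> (edge_pt H len' e' (t' + s' * h)) = z h" if h: "0 < h" "h < d" for h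
  proof -
    obtain e1 t1 s1 where dir1: "(e1, t1, s1) \<in> directions H len' p'"
      "edge_pt H len' e1 (t1 + s1 * h) \<in> points H len'" "\<phi> (edge_pt H len' e1 (t1 + s1 * h)) = z h"
      using dir[OF h] by auto
    have eq: "path_dist H len' (edge_pt H len' e' (t' + s' * (d / 2))) (edge_pt H len' e1 (t1 + s1 * h)) = \<bar>h - d / 2\<bar>"
      using iso[OF dir0(2) dir1(2)] dir0(3) dir1(3) z_dist[of "d / 2" h] h by simp
    have "(e1, t1, s1) = (e', t', s')"
    proof (rule ccontr)
      assume ne: "(e1, t1, s1) \<noteq> (e', t', s')"
      \<comment> \<open>On a different leg the distance to the reference point would be at least d /
        2, but it is \<open>\<bar>h - d / 2\<bar>\<close> with 0 < h < d.\<close>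
      have "d / 2 \<le> \<bar>h - d / 2\<bar>"
        using \<epsilon>(4)[OF dir0(1) dir1(1) ne[symmetric], of "d / 2" h] d h eq by simp
      moreover have "h \<le> \<bar>h - d / 2\<bar>"
        using \<epsilon>(4)[OF dir1(1) dir0(1) ne, of h "d / 2"] d h eq H.path_dist_commute by simp
      ultimately show False using h by linarith
    qed
    with dir1 show ?thesis by simp
  qed
  have e': "e' \<in> arcs H" "edge_pt H len' e' t' = p'" "s' = 1 \<or> s' = -1"
    using dir0(1) by (auto simp: directions_def)
  obtain a :: int and b where ab: "\<And>u. 0 \<le> u \<Longrightarrow> u \<le> len' e' \<Longrightarrow> f (\<phi> (edge_pt H len' e' u)) = of_int a * u + b"
    using H(2)[OF e'(1)] by blast
  \<comment> \<open>The leg may run against the orientation of its edge in H.\<close>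
  define a' where "a' = (if s' = 1 then a else - a)"
  have a': "of_int a' = of_int a * s'" using e'(3) by (auto simp: a'_def)
  have "f (z h) = f p + of_int a' * h" if h: "0 < h" "h < d" for h
  proof -
    have "f (z h) = of_int a * (t' + s' * h) + b"
      using dir'[OF h] ab[of "t' + s' * h"] \<epsilon>(3)[OF dir0(1), of h] h d(2) by simp
    moreover have "f p = of_int a * t' + b"
      using ab[of t'] \<epsilon>(3)[OF dir0(1), of 0] \<epsilon>(1) e'(2) p' by simp
    ultimately show ?thesis by (simp add: a' algebra_simps)
  qed
  then have "has_slope G len f \<delta> a'"
    unfolding \<delta>' has_slope_def prod.case eventually_at_right_field
    using d(1) by (intro exI[of _ d]) (auto simp: z_def e(4))
  then show "\<exists>a. has_slope G len f \<delta> a" ..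
qed

theorem PL_Z_iff_locally_linear: "f \<in> PL_Z G len \<longleftrightarrow> locally_linear G len f"
  using PL_Z_imp_locally_linear locally_linear_imp_PL_Z by blast

end


section \<open>Divisors and torsion\<close>

context metric_graph
begin

definition total_slope :: "(('v, 'e) point \<Rightarrow> real) \<Rightarrow> ('v, 'e) point \<Rightarrow> real" where
  "total_slope f x = (\<Sum>\<delta>\<in>directions G len x. outgoing_slope G len f \<delta>)"

lemma total_slope_Interior:
  "e \<in> arcs G \<Longrightarrow> 0 < t \<Longrightarrow> t < len e \<Longrightarrow> total_slope f (Interior e t) = bend f e t"
  by (simp add: total_slope_def directions_Interior bend_def)

lemma total_slope_Vertex:
  "total_slope f (Vertex v) = (\<Sum>e | e \<in> arcs G \<and> tail G e = v. outgoing_slope G len f (e, 0, 1)) +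
     (\<Sum>e | e \<in> arcs G \<and> head G e = v. outgoing_slope G len f (e, len e, -1))"
  unfolding total_slope_def directions_Vertex
  by (subst sum.union_disjoint) (auto simp: sum.reindex inj_on_def)

lemma total_slope_outside: "x \<notin> points G len \<Longrightarrow> total_slope f x = 0"
  unfolding total_slope_def by (rule sum.neutral) (auto simp: directions_def points_def)

text \<open>\<open>Abs_poly_mapping\<close> returns the intended function only for finite support,
  and the floor is exact only at integers. Slopes are integral, and the total slope vanishes outside
  the vertices and the finitely many bends.\<close>

lemma lookup_laplacian:
  assumes f: "locally_linear G len f"
  shows "of_int (Poly_Mapping.lookup (laplacian G len f) x) = - total_slope f x"
proof -
  have int: "total_slope f x \<in> \<int>" for x
    unfolding total_slope_def
  proof (rule Ints_sum)
    fix \<delta> assume "\<delta> \<in> directions G len x"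
    then obtain a where "has_slope G len f \<delta> a" using f unfolding locally_linear_def by blast
    then show "outgoing_slope G len f \<delta> \<in> \<int>" by (simp add: outgoing_slope_eq)
  qed
  have "{x. total_slope f x \<noteq> 0} \<subseteq>
      Vertex ` verts G \<union> (\<Union>e\<in>arcs G. Interior e ` {t. 0 < t \<and> t < len e \<and> bend f e t \<noteq> 0})"
  proof
    fix x assume "x \<in> {x. total_slope f x \<noteq> 0}"
    then have x: "total_slope f x \<noteq> 0" "x \<in> points G len" using total_slope_outside by auto
    from x(2) consider v where "v \<in> verts G" "x = Vertex v"
      | e t where "e \<in> arcs G" "0 < t" "t < len e" "x = Interior e t"
      unfolding points_alt by blast
    then show "x \<in> Vertex ` verts G \<union> (\<Union>e\<in>arcs G. Interior e ` {t. 0 < t \<and> t < len e \<and> bend f e t \<noteq> 0})"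
    proof cases
      case 2
      then have "bend f e t \<noteq> 0" using x(1) by (simp add: total_slope_Interior)
      with 2 show ?thesis by blast
    qed simp
  qed
  moreover have "finite (Vertex ` verts G \<union> (\<Union>e\<in>arcs G. Interior e ` {t. 0 < t \<and> t < len e \<and> bend f e t \<noteq> 0}))"
    using finite_bends[OF f] by simp
  ultimately have "finite {x. total_slope f x \<noteq> 0}" by (rule finite_subset)
  then have fin: "finite {x. - \<lfloor>total_slope f x\<rfloor> \<noteq> 0}"
    by (rule rev_finite_subset) auto
  show ?thesis
    unfolding laplacian_def total_slope_def[symmetric] lookup_Abs_poly_mapping[OF fin]
    using int[of x] by (auto elim: Ints_cases)
qed

lemma laplacian_eqI:
  assumes "locally_linear G len f" "\<And>x. total_slope f x = - of_int (Poly_Mapping.lookup D x)"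
  shows "laplacian G len f = D"
proof (rule poly_mapping_eqI)
  fix x
  have "real_of_int (Poly_Mapping.lookup (laplacian G len f) x) = of_int (Poly_Mapping.lookup D x)"
    using lookup_laplacian[OF assms(1), of x] assms(2)[of x] by simp
  then show "Poly_Mapping.lookup (laplacian G len f) x = Poly_Mapping.lookup D x" by simp
qed

section \<open>Principal divisors and Abel-Jacobi classes\<close>

lemma principal_divisors_add:
  assumes "D \<in> principal_divisors G len" "E \<in> principal_divisors G len"
  shows "D + E \<in> principal_divisors G len"
proof -
  obtain f g where f: "locally_linear G len f" "D = laplacian G len f"
    and g: "locally_linear G len g" "E = laplacian G len g"
    using assms by (auto simp: principal_divisors_def PL_Z_iff_locally_linear)
  have slope: "outgoing_slope G len (\<lambda>x. f x + g x) \<delta> = outgoing_slope G len f \<delta> + outgoing_slope G len g \<delta>"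
    if \<delta>: "\<delta> \<in> directions G len x" for \<delta> x
  proof -
    obtain a b where ab: "has_slope G len f \<delta> a" "has_slope G len g \<delta> b"
      using f g \<delta> unfolding locally_linear_def by blast
    from outgoing_slope_eq[OF has_slope_add[OF this]] ab[THEN outgoing_slope_eq] show ?thesis by simp
  qed
  have "total_slope (\<lambda>x. f x + g x) x = total_slope f x + total_slope g x" for x
    using slope[of _ x] by (simp add: total_slope_def sum.distrib)
  then have "laplacian G len (\<lambda>x. f x + g x) = D + E"
    using lookup_laplacian[OF f(1)] lookup_laplacian[OF g(1)]
    by (intro laplacian_eqI locally_linear_add f g) (simp add: f g lookup_add)
  then show ?thesis
    using locally_linear_add[OF f(1) g(1)] unfolding principal_divisors_def
    by (intro image_eqI[of _ _ "\<lambda>x. f x + g x"]) (auto simp: PL_Z_iff_locally_linear)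
qed

lemma principal_divisors_uminus:
  assumes "D \<in> principal_divisors G len"
  shows "- D \<in> principal_divisors G len"
proof -
  obtain f where f: "locally_linear G len f" "D = laplacian G len f"
    using assms by (auto simp: principal_divisors_def PL_Z_iff_locally_linear)
  have slope: "outgoing_slope G len (\<lambda>x. - f x) \<delta> = - outgoing_slope G len f \<delta>"
    if \<delta>: "\<delta> \<in> directions G len x" for \<delta> x
  proof -
    obtain a where a: "has_slope G len f \<delta> a"
      using f \<delta> unfolding locally_linear_def by blast
    from outgoing_slope_eq[OF has_slope_uminus[OF this]] outgoing_slope_eq[OF a] show ?thesis by simp
  qed
  have "total_slope (\<lambda>x. - f x) x = - total_slope f x" for x
    using slope[of _ x] by (simp add: total_slope_def sum_negf)
  then have "laplacian G len (\<lambda>x. - f x) = - D"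
    using lookup_laplacian[OF f(1)]
    by (intro laplacian_eqI locally_linear_uminus f) (simp add: f)
  then show ?thesis
    using locally_linear_uminus[OF f(1)] unfolding principal_divisors_def
    by (intro image_eqI[of _ _ "\<lambda>x. - f x"]) (auto simp: PL_Z_iff_locally_linear)
qed

lemma zero_in_principal_divisors: "0 \<in> principal_divisors G len"
proof -
  have slope: "has_slope G len (\<lambda>_. 0) \<delta> 0" for \<delta>
    by (cases \<delta>) (simp add: has_slope_def)
  then have "locally_linear G len (\<lambda>_. 0)" unfolding locally_linear_def by blast
  then have "laplacian G len (\<lambda>_. 0) \<in> principal_divisors G len"
    by (simp add: principal_divisors_def PL_Z_iff_locally_linear)
  from principal_divisors_add[OF this principal_divisors_uminus[OF this]] show ?thesis by simp
qed

lemma abel_jacobi_eq: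
  "abel_jacobi G len q x = (\<lambda>D. D + (frag_of x - frag_of q)) ` principal_divisors G len"
  by (auto simp: abel_jacobi_def r_coset_def Div0_def Div_def free_Abelian_group_def)

lemma abel_jacobi_eq_imp_principal:
  assumes "abel_jacobi G len q x = abel_jacobi G len q y"
  shows "frag_of x - frag_of y \<in> principal_divisors G len"
proof -
  have "0 + (frag_of x - frag_of q) \<in> abel_jacobi G len q x"
    unfolding abel_jacobi_eq using zero_in_principal_divisors by (rule imageI)
  then have "0 + (frag_of x - frag_of q) \<in> (\<lambda>D. D + (frag_of y - frag_of q)) ` principal_divisors G len"
    by (simp only: assms abel_jacobi_eq[of q y])
  then obtain D where D: "D \<in> principal_divisors G len" "0 + (frag_of x - frag_of q) = D + (frag_of y - frag_of q)"
    by (elim imageE)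
  from D(2) have "frag_of x - frag_of y = D" by (simp add: algebra_simps)
  with D(1) show ?thesis by simp
qed

lemma deg_diff_frag_of: "deg (frag_of x - frag_of y) = 0"
proof (cases "x = y")
  case False
  then have "Poly_Mapping.keys (frag_of x - frag_of y) = {x, y}"
    by (auto simp: in_keys_iff lookup_minus split: if_splits)
  with False show ?thesis by (simp add: deg_def lookup_minus)
qed (simp add: deg_def)

lemma abel_jacobi_in_torsion:
  assumes q: "q \<in> points G len" and x: "x \<in> points G len" and n: "0 < n"
    and principal: "frag_cmul (int n) (frag_of x - frag_of q) \<in> principal_divisors G len"
  shows "abel_jacobi G len q x \<in> torsion (Jac G len)"
proof -
  let ?P = "principal_divisors G len"
  let ?a = "frag_of x - frag_of q"
  \<comment> \<open>The product in the factor group is the elementwise sum of cosets. Since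
    principal divisors are closed under sums and contain 0, the k-th power is the coset of k times
    the representative.\<close>
  have pow: "abel_jacobi G len q x [^]\<^bsub>Jac G len\<^esub> k = (\<lambda>D. D + frag_cmul (int k) ?a) ` ?P" for k :: nat
  proof (induction k)
    case 0
    then show ?case by (simp add: Jac_def FactGroup_def)
  next
    case (Suc k)
    have "abel_jacobi G len q x [^]\<^bsub>Jac G len\<^esub> Suc k =
        (\<Union>D\<in>?P. \<Union>E\<in>?P. {(D + frag_cmul (int k) ?a) + (E + ?a)})"
      unfolding nat_pow_Suc Suc.IH unfolding abel_jacobi_eq
      by (simp add: Jac_def FactGroup_def set_mult_def Div0_def Div_def free_Abelian_group_def)
    also have "\<dots> = (\<lambda>D. D + frag_cmul (int (Suc k)) ?a) ` ?P"
    proof (intro equalityI subsetI)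
      fix z assume "z \<in> (\<Union>D\<in>?P. \<Union>E\<in>?P. {(D + frag_cmul (int k) ?a) + (E + ?a)})"
      then obtain D E where DE: "D \<in> ?P" "E \<in> ?P" "z = (D + frag_cmul (int k) ?a) + (E + ?a)" by blast
      then have "z = (D + E) + frag_cmul (int (Suc k)) ?a"
        by (simp add: frag_cmul_distrib algebra_simps)
      with principal_divisors_add[OF DE(1,2)] show "z \<in> (\<lambda>D. D + frag_cmul (int (Suc k)) ?a) ` ?P"
        by (rule image_eqI[rotated])
    next
      fix z assume "z \<in> (\<lambda>D. D + frag_cmul (int (Suc k)) ?a) ` ?P"
      then obtain D where "D \<in> ?P" "z = D + frag_cmul (int (Suc k)) ?a" by blast
      then have "D \<in> ?P" "z = (D + frag_cmul (int k) ?a) + (0 + ?a)"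
        by (simp_all add: frag_cmul_distrib algebra_simps)
      with zero_in_principal_divisors
      show "z \<in> (\<Union>D\<in>?P. \<Union>E\<in>?P. {(D + frag_cmul (int k) ?a) + (E + ?a)})" by blast
    qed
    finally show ?case .
  qed
  have "(\<lambda>D. D + frag_cmul (int n) ?a) ` ?P = ?P"
  proof (intro equalityI subsetI)
    fix D assume "D \<in> ?P"
    then have "D + - frag_cmul (int n) ?a \<in> ?P"
      by (intro principal_divisors_add principal_divisors_uminus principal)
    then show "D \<in> (\<lambda>D. D + frag_cmul (int n) ?a) ` ?P"
      by (rule image_eqI[rotated]) (simp only: add.assoc add.left_inverse add_0_right)
  qed (use principal_divisors_add[OF _ principal] in blast)
  then have "abel_jacobi G len q x [^]\<^bsub>Jac G len\<^esub> n = \<one>\<^bsub>Jac G len\<^esub>"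
    unfolding pow by (simp add: Jac_def FactGroup_def)
  moreover have "abel_jacobi G len q x \<in> carrier (Jac G len)"
  proof -
    have "Poly_Mapping.keys ?a \<subseteq> points G len"
      using q x keys_diff[of "frag_of x" "frag_of q"] by auto
    then have "?a \<in> carrier (Div0 G len)"
      by (simp add: Div0_def Div_def free_Abelian_group_def deg_diff_frag_of)
    then show ?thesis by (auto simp: Jac_def FactGroup_def RCOSETS_def abel_jacobi_def)
  qed
  ultimately show ?thesis unfolding torsion_def using n by blast
qed

text \<open>Interpolation of vertex values with slope \<open>a e\<close> up to the break point and
  \<open>b e\<close> after it; the second hypothesis says that the value at the head is met. A break
  point with a e = b e is invisible, so all edges can be treated alike.\<close>

lemma exists_once_bent:
  fixes a b :: "'e \<Rightarrow> int"
  assumes c: "\<And>e. e \<in> arcs G \<Longrightarrow> 0 < c e \<and> c e < len e"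
    and \<phi>: "\<And>e. e \<in> arcs G \<Longrightarrow> \<phi> (head G e) - \<phi> (tail G e) = of_int (a e) * c e + of_int (b e) * (len e - c e)"
  obtains F where "locally_linear G len F"
    "\<And>e t. e \<in> arcs G \<Longrightarrow> 0 < t \<Longrightarrow> t < len e \<Longrightarrow>
       total_slope F (Interior e t) = (if t = c e then of_int (b e) - of_int (a e) else 0)"
    "\<And>v. total_slope F (Vertex v) =
       of_int ((\<Sum>e | e \<in> arcs G \<and> tail G e = v. a e) - (\<Sum>e | e \<in> arcs G \<and> head G e = v. b e))"
proof -
  define F where "F x = (case x of Vertex v \<Rightarrow> \<phi> v
    | Interior e t \<Rightarrow> \<phi> (tail G e) + of_int (a e) * min t (c e) + of_int (b e) * max 0 (t - c e))"
    for x :: "('v, 'e) point"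
  have F: "F (edge_pt G len e t) = \<phi> (tail G e) + of_int (a e) * min t (c e) + of_int (b e) * max 0 (t - c e)"
    if "e \<in> arcs G" "0 \<le> t" "t \<le> len e" for e t
  proof (cases "t = len e")
    case True
    then show ?thesis using c[OF that(1)] \<phi>[OF that(1)] that(1) by (simp add: F_def)
  next
    case False
    then show ?thesis using c[OF that(1)] that by (cases "t = 0") (simp_all add: F_def)
  qed
  have small: "\<forall>\<^sub>F h in at_right 0. 0 < h \<and> h < d" if "0 < d" for d :: real
    using that by (auto simp: eventually_at_right_field)
  \<comment> \<open>At the break point itself the slope ahead is already \<open>b e\<close>, while
    the slope behind is still \<open>a e\<close>: hence the strict inequality here and the weak one
    in \<open>left\<close>.\<close>
  have right: "has_slope G len F (e, t, 1) (if t < c e then a e else b e)"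
    if e: "e \<in> arcs G" "0 \<le> t" "t < len e" for e t
    unfolding has_slope_def prod.case
  proof (rule eventually_mono[OF small[of "if t < c e then c e - t else len e - t"]])
    fix h assume h: "0 < h \<and> h < (if t < c e then c e - t else len e - t)"
    then have "t + 1 * h \<le> len e" "0 \<le> t + 1 * h" using e c[OF e(1)] by (auto split: if_splits)
    then show "F (edge_pt G len e (t + 1 * h)) = F (edge_pt G len e t) + of_int (if t < c e then a e else b e) * h"
      using h e by (subst (1 2) F) (auto simp: algebra_simps min_def max_def split: if_splits)
  qed (use e in auto)
  have left: "has_slope G len F (e, t, -1) (if t \<le> c e then - a e else - b e)"
    if e: "e \<in> arcs G" "0 < t" "t \<le> len e" for e t
    unfolding has_slope_def prod.case
  proof (rule eventually_mono[OF small[of "if t \<le> c e then t else t - c e"]])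
    fix h assume h: "0 < h \<and> h < (if t \<le> c e then t else t - c e)"
    then have "t + -1 * h \<le> len e" "0 \<le> t + -1 * h" using e c[OF e(1)] by (auto split: if_splits)
    then show "F (edge_pt G len e (t + -1 * h)) = F (edge_pt G len e t) + of_int (if t \<le> c e then - a e else - b e) * h"
      using h e by (subst (1 2) F) (auto simp: algebra_simps min_def max_def split: if_splits)
  qed (use e in auto)
  show thesis
  proof (rule that[of F])
    show "locally_linear G len F"
      unfolding locally_linear_def
    proof (intro allI ballI)
      fix x \<delta> assume "\<delta> \<in> directions G len x"
      then obtain e t s where "\<delta> = (e, t, s)" "e \<in> arcs G" "0 \<le> t" "t \<le> len e"
        "s = 1 \<and> t < len e \<or> s = -1 \<and> 0 < t"
        by (auto simp: directions_def)
      then show "\<exists>k. has_slope G len F \<delta> k" using right[of e t] left[of e t] by blast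
    qed
    show "total_slope F (Interior e t) = (if t = c e then of_int (b e) - of_int (a e) else 0)"
      if "e \<in> arcs G" "0 < t" "t < len e" for e t
      using outgoing_slope_eq[OF right[of e t]] outgoing_slope_eq[OF left[of e t]] that
      by (simp add: total_slope_Interior bend_def)
    show "total_slope F (Vertex v) =
        of_int ((\<Sum>e | e \<in> arcs G \<and> tail G e = v. a e) - (\<Sum>e | e \<in> arcs G \<and> head G e = v. b e))" for v
    proof -
      have "outgoing_slope G len F (e, 0, 1) = of_int (a e)" if "e \<in> arcs G" for e
        using outgoing_slope_eq[OF right[of e 0]] that c[OF that] len_pos[OF that] by simp
      moreover have "outgoing_slope G len F (e, len e, -1) = - of_int (b e)" if "e \<in> arcs G" for e
        using outgoing_slope_eq[OF left[of e "len e"]] that c[OF that] len_pos[OF that] by simp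
      ultimately show ?thesis by (simp add: total_slope_Vertex sum_negf)
    qed
  qed
qed

text \<open>Superposition. The potential scaled by b has total slope n * b at the tail of
  \<open>e0\<close> and -n * b at the head. A tent with slopes n * a and -n * b on \<open>e0\<close>
  adds n * a at the tail, n * b at the head and -n * (a + b) at t, so the head cancels. On a loop
  the potential contributes nothing and the tent alone gives n * (a + b) at the vertex.\<close>

lemma rational_point_torsion:
  assumes e0: "e0 \<in> arcs G" and rat: "\<forall>e\<in>arcs G. len e \<in> \<rat>"
    and t: "t \<in> \<rat>" "0 < t" "t < len e0"
  shows "\<exists>n > 0. frag_cmul (int n) (frag_of (Interior e0 t) - frag_of (Vertex (tail G e0))) \<in> principal_divisors G len"
proof -
  obtain \<phi> :: "'v \<Rightarrow> real" and m :: "'e \<Rightarrow> int" and n :: int where n: "0 < n"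
    and \<phi>: "\<And>e. e \<in> arcs G \<Longrightarrow> \<phi> (head G e) - \<phi> (tail G e) = of_int (m e) * len e"
    and m: "\<And>v. v \<in> verts G \<Longrightarrow> outflow m v = n * (of_bool (v = tail G e0) - of_bool (v = head G e0))"
    by (rule exists_potential[OF e0 rat]) blast
  have "(len e0 - t) / t \<in> \<rat>" using t e0 rat by simp
  then obtain a b :: int where ab: "0 < b" "(len e0 - t) / t = of_int a / of_int b"
    by (rule Rats_cases') auto
  have "0 < real_of_int a / of_int b" unfolding ab(2)[symmetric] using t by simp
  then have a: "0 < a" using ab(1) by (simp add: zero_less_divide_iff)
  \<comment> \<open>This is the condition for the tent to vanish at both ends of
    \<open>e0\<close>.\<close>
  have abt: "of_int a * t = of_int b * (len e0 - t)"
    using ab t by (simp add: field_simps)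
  \<comment> \<open>Away from \<open>e0\<close> the slopes \<open>A e\<close> and \<open>B e\<close>
    coincide, so any interior parameter serves as break point.\<close>
  define c where "c e = (if e = e0 then t else len e / 2)" for e
  define A where "A e = b * m e + n * a * of_bool (e = e0)" for e
  define B where "B e = b * m e - n * b * of_bool (e = e0)" for e
  have c: "0 < c e \<and> c e < len e" if "e \<in> arcs G" for e
    using that t len_pos[OF that] by (auto simp: c_def)
  have incr: "of_int b * \<phi> (head G e) - of_int b * \<phi> (tail G e) =
      of_int (A e) * c e + of_int (B e) * (len e - c e)" if "e \<in> arcs G" for e
  proof -
    have "of_int b * \<phi> (head G e) - of_int b * \<phi> (tail G e) = of_int b * (of_int (m e) * len e)"
      using \<phi>[OF that] by (simp add: right_diff_distrib[symmetric])
    also have "\<dots> = of_int (A e) * c e + of_int (B e) * (len e - c e) -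
        of_bool (e = e0) * (of_int n * (of_int a * t - of_int b * (len e0 - t)))"
      by (simp add: A_def B_def c_def algebra_simps)
    finally show ?thesis using abt by simp
  qed
  from exists_once_bent[of c "\<lambda>v. of_int b * \<phi> v" A B, OF c incr]
  obtain F where F: "locally_linear G len F"
    and F_Interior: "\<And>e t. e \<in> arcs G \<Longrightarrow> 0 < t \<Longrightarrow> t < len e \<Longrightarrow>
       total_slope F (Interior e t) = (if t = c e then of_int (B e) - of_int (A e) else 0)"
    and F_Vertex: "\<And>v. total_slope F (Vertex v) =
       of_int ((\<Sum>e | e \<in> arcs G \<and> tail G e = v. A e) - (\<Sum>e | e \<in> arcs G \<and> head G e = v. B e))"
    by blast
  define k where "k = n * (a + b)"
  have "laplacian G len F = frag_cmul k (frag_of (Interior e0 t) - frag_of (Vertex (tail G e0)))"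
  proof (rule laplacian_eqI[OF F])
    fix x :: "('v, 'e) point"
    consider "x \<notin> points G len" | v where "v \<in> verts G" "x = Vertex v"
      | e u where "e \<in> arcs G" "0 < u" "u < len e" "x = Interior e u"
      unfolding points_alt by blast
    then show "total_slope F x = - of_int (Poly_Mapping.lookup
        (frag_cmul k (frag_of (Interior e0 t) - frag_of (Vertex (tail G e0)))) x)"
    proof cases
      case 1
      then have "x \<noteq> Interior e0 t" "x \<noteq> Vertex (tail G e0)" using e0 t by (auto simp: points_alt)
      with 1 show ?thesis by (simp add: total_slope_outside lookup_minus)
    next
      case 2
      have "(\<Sum>e | e \<in> arcs G \<and> tail G e = v. A e) =
          b * (\<Sum>e | e \<in> arcs G \<and> tail G e = v. m e) + n * a * of_bool (v = tail G e0)"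
        using e0 by (auto simp: A_def sum.distrib sum_distrib_left[symmetric] of_bool_def)
      moreover have "(\<Sum>e | e \<in> arcs G \<and> head G e = v. B e) =
          b * (\<Sum>e | e \<in> arcs G \<and> head G e = v. m e) - n * b * of_bool (v = head G e0)"
        using e0 by (auto simp: B_def sum_subtractf sum_distrib_left[symmetric] of_bool_def)
      ultimately have "(\<Sum>e | e \<in> arcs G \<and> tail G e = v. A e) - (\<Sum>e | e \<in> arcs G \<and> head G e = v. B e) =
          b * outflow m v + n * a * of_bool (v = tail G e0) + n * b * of_bool (v = head G e0)"
        by (simp add: outflow_def algebra_simps)
      also have "\<dots> = k * of_bool (v = tail G e0)"
        unfolding m[OF 2(1)] by (simp add: k_def algebra_simps)
      finally show ?thesis unfolding 2(2) F_Vertex by (simp add: lookup_minus)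
    next
      case 3
      have "(if u = c e then real_of_int (B e) - of_int (A e) else 0) =
          (if e = e0 \<and> u = t then - of_int k else 0)"
        by (auto simp: c_def A_def B_def k_def algebra_simps)
      with 3 show ?thesis by (auto simp: F_Interior lookup_minus)
    qed
  qed
  moreover have "laplacian G len F \<in> principal_divisors G len"
    using F by (simp add: principal_divisors_def PL_Z_iff_locally_linear)
  moreover have "0 < k" using n a ab(1) by (simp add: k_def)
  ultimately show ?thesis by (intro exI[of _ "nat k"]) simp
qed

text \<open>
  Pairing the gradient of \<open>f\<close> with the cycle \<open>C\<close> yields \<open>0\<close>. As \<open>f\<close> has integer slopes and bends at \<open>t\<close> and \<open>t'\<close>
  only, the pairing is \<open>\<plusminus> C e0 * (t' - t)\<close> up to a multiple of \<open>1 / N\<close>.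
\<close>

lemma equivalent_points_distance:
  fixes C :: "'e \<Rightarrow> int" and N :: int
  assumes e0: "e0 \<in> arcs G" and C: "\<And>v. v \<in> verts G \<Longrightarrow> outflow C v = 0"
    and N: "\<And>e. e \<in> arcs G \<Longrightarrow> of_int N * len e \<in> \<int>"
    and t: "0 < t" "t < t'" "t' < len e0"
    and principal: "frag_of (Interior e0 t) - frag_of (Interior e0 t') \<in> principal_divisors G len"
  shows "of_int (C e0 * N) * (t' - t) \<in> \<int>"
proof -
  obtain f where f: "locally_linear G len f"
    "laplacian G len f = frag_of (Interior e0 t) - frag_of (Interior e0 t')"
    using principal by (auto simp: principal_divisors_def PL_Z_iff_locally_linear)
  have bend: "bend f e u = of_bool (e = e0 \<and> u = t') - of_bool (e = e0 \<and> u = t)"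
    if "e \<in> arcs G" "0 < u" "u < len e" for e u
    using lookup_laplacian[OF f(1), of "Interior e u"] t that
    by (auto simp: total_slope_Interior f(2) lookup_minus split: if_splits)
  define g where "g v = f (Vertex v)" for v
  have gN: "of_int N * (g (head G e) - g (tail G e)) + of_bool (e = e0) * of_int N * (t' - t) \<in> \<int>"
    if e: "e \<in> arcs G" for e
  proof -
    \<comment> \<open>\<open>laplacian\<close> carries a minus sign: the slope drops by one at t and
      recovers at t', which accounts for the correction term on \<open>e0\<close>.\<close>
    have "\<exists>a :: int. g (head G e) - g (tail G e) + of_bool (e = e0) * (t' - t) = of_int a * len e"
    proof (cases "e = e0")
      case False
      then have "bend f e u = 0" if "0 < u" "u < len e" for u using bend[OF e that] by simp
      from linear_between_bends[OF f(1) e order_refl len_pos[OF e] order_refl this]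
      obtain a :: int where "\<forall>u. 0 \<le> u \<longrightarrow> u \<le> len e \<longrightarrow>
          f (edge_pt G len e u) = f (edge_pt G len e 0) + of_int a * (u - 0)" by blast
      from this[rule_format, of "len e"] show ?thesis using len_pos[OF e] e False by (auto simp: g_def)
    next
      case True
      have arc: "e0 \<in> arcs G" "0 \<le> t" "0 \<le> t'" "t \<le> len e0" using t e0 by auto
      have t': "0 < t'" "t < len e0" using t by auto
      have straight: "\<And>u. 0 < u \<Longrightarrow> u < t \<Longrightarrow> bend f e0 u = 0"
        "\<And>u. t < u \<Longrightarrow> u < t' \<Longrightarrow> bend f e0 u = 0" "\<And>u. t' < u \<Longrightarrow> u < len e0 \<Longrightarrow> bend f e0 u = 0"
        using bend[OF e0] t by auto
      obtain a1 :: int where a1: "\<forall>u. 0 \<le> u \<longrightarrow> u \<le> t \<longrightarrow>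
          f (edge_pt G len e0 u) = f (edge_pt G len e0 0) + of_int a1 * (u - 0)"
        "has_slope G len f (e0, t, -1) (-a1)"
        using linear_between_bends[OF f(1) e0 order_refl t(1) arc(4) straight(1)] by blast
      obtain a2 :: int where a2: "\<forall>u. t \<le> u \<longrightarrow> u \<le> t' \<longrightarrow>
          f (edge_pt G len e0 u) = f (edge_pt G len e0 t) + of_int a2 * (u - t)"
        "has_slope G len f (e0, t, 1) a2" "has_slope G len f (e0, t', -1) (-a2)"
        using linear_between_bends[OF f(1) e0 arc(2) t(2) less_imp_le[OF t(3)] straight(2)] by blast
      obtain a3 :: int where a3: "\<forall>u. t' \<le> u \<longrightarrow> u \<le> len e0 \<longrightarrow>
          f (edge_pt G len e0 u) = f (edge_pt G len e0 t') + of_int a3 * (u - t')"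
        "has_slope G len f (e0, t', 1) a3"
        using linear_between_bends[OF f(1) e0 arc(3) t(3) order_refl straight(3)] by blast
      have "real_of_int a2 - of_int a1 = -1"
        using bend[OF e0 t(1) t'(2)] outgoing_slope_eq[OF a1(2)] outgoing_slope_eq[OF a2(2)] t
        by (simp add: bend_def)
      moreover have "real_of_int a3 - of_int a2 = 1"
        using bend[OF e0 t'(1) t(3)] outgoing_slope_eq[OF a2(3)] outgoing_slope_eq[OF a3(2)] t
        by (simp add: bend_def)
      ultimately have a: "real_of_int a2 = of_int a1 - 1" "real_of_int a3 = of_int a1" by auto
      have "g (head G e0) - g (tail G e0) = of_int a1 * t + of_int a2 * (t' - t) + of_int a3 * (len e0 - t')"
        using a1(1)[rule_format, of t] a2(1)[rule_format, of t'] a3(1)[rule_format, of "len e0"] t e0 by (simp add: g_def)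
      then have "g (head G e0) - g (tail G e0) + (t' - t) = of_int a1 * len e0"
        unfolding a by (simp add: algebra_simps)
      then show ?thesis using True by auto
    qed
    then obtain a :: int where a: "g (head G e) - g (tail G e) + of_bool (e = e0) * (t' - t) = of_int a * len e" ..
    have "of_int N * (g (head G e) - g (tail G e)) + of_bool (e = e0) * of_int N * (t' - t) =
        of_int N * (g (head G e) - g (tail G e) + of_bool (e = e0) * (t' - t))"
      by (simp add: distrib_left mult_ac)
    also have "\<dots> = of_int a * (of_int N * len e)"
      unfolding a by simp
    finally show ?thesis using N[OF e] by (simp only: Ints_mult Ints_of_int)
  qed
  have "(\<Sum>e\<in>arcs G. of_int (C e) * (g (head G e) - g (tail G e))) = 0"
  proof -
    have "outflow (\<lambda>e. real_of_int (C e)) v = of_int (outflow C v)" for v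
      by (simp add: outflow_def)
    then show ?thesis
      using C sum_arcs_by_parts[of "\<lambda>e. real_of_int (C e)" g] by simp
  qed
  \<comment> \<open>The correction occurs on \<open>e0\<close> only, so this integer equals a
    multiple of the pairing with the cycle, which is 0, plus the term of interest.\<close>
  moreover have "(\<Sum>e\<in>arcs G. of_int (C e) * (of_int N * (g (head G e) - g (tail G e)) + of_bool (e = e0) * of_int N * (t' - t))) =
      of_int N * (\<Sum>e\<in>arcs G. of_int (C e) * (g (head G e) - g (tail G e))) + of_int (C e0 * N) * (t' - t)"
  proof -
    have "(\<Sum>e\<in>arcs G. of_int (C e) * (of_bool (e = e0) * of_int N * (t' - t))) =
        (\<Sum>e\<in>arcs G. if e = e0 then of_int (C e0 * N) * (t' - t) else 0)"
      by (rule sum.cong) auto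
    also have "\<dots> = of_int (C e0 * N) * (t' - t)" using e0 by simp
    finally show ?thesis
      by (simp add: distrib_left sum.distrib sum_distrib_left mult.left_commute)
  qed
  moreover have "(\<Sum>e\<in>arcs G. of_int (C e) * (of_int N * (g (head G e) - g (tail G e)) + of_bool (e = e0) * of_int N * (t' - t))) \<in> \<int>"
    using gN by (intro Ints_sum Ints_mult[OF Ints_of_int]) auto
  ultimately show ?thesis by simp
qed

end


section \<open>Infinitely many torsion classes on one edge\<close>

theorem mainTheorem2:
  fixes G :: "('v, 'e) pre_digraph" and len :: "'e \<Rightarrow> real"
  assumes "metric_graph G len"
    and "genus G \<ge> 2"
    and "\<forall>e \<in> arcs G. len e \<in> \<rat>"
  shows "\<not> manin_mumford G len"
proof -
  interpret metric_graph G len by fact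
  obtain C :: "'e \<Rightarrow> int" and e0 where C: "e0 \<in> arcs G" "C e0 \<noteq> 0" "\<And>v. v \<in> verts G \<Longrightarrow> outflow C v = 0"
    using exists_cycle assms(2) by auto
  obtain N :: int where N: "0 < N" "\<And>e. e \<in> arcs G \<Longrightarrow> of_int N * len e \<in> \<int>"
    using common_denominator[OF finite_arcs, of len] assms(3) by blast
  define q :: "('v, 'e) point" where "q = Vertex (tail G e0)"
  \<comment> \<open>Two distinct parameters in (0, \<epsilon>) differ by less than
    \<open>1 / of_int (\<bar>C e0\<bar> * N)\<close>, so C e0 * N times their difference is nonzero
    of absolute value below 1, hence not an integer. The bound \<open>len e0\<close> keeps the
    points on the edge.\<close>
  define \<epsilon> where "\<epsilon> = min (len e0) (1 / of_int (\<bar>C e0\<bar> * N))"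
  have \<epsilon>: "0 < \<epsilon>" using C(2) N(1) len_pos[OF C(1)] by (simp add: \<epsilon>_def)
  define T where "T = {t \<in> \<rat>. 0 < t \<and> t < \<epsilon>}"
  have T: "Interior e0 t \<in> points G len" "t \<in> \<rat>" "0 < t" "t < len e0" if "t \<in> T" for t
    using that C(1) by (auto simp: T_def \<epsilon>_def points_alt)
  have q: "q \<in> points G len" using C(1) by (simp add: q_def points_def)
  have "infinite T"
  proof
    assume "finite T"
    obtain r where "r \<in> \<rat>" "0 < r" "r < \<epsilon>" using Rats_dense_in_real[OF \<epsilon>] by blast
    then have "T \<noteq> {}" by (auto simp: T_def)
    then have "0 < Min T" using \<open>finite T\<close> by (auto simp: T_def)
    then obtain r where "r \<in> \<rat>" "0 < r" "r < Min T" using Rats_dense_in_real by blast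
    moreover have "Min T < \<epsilon>" using Min_in[OF \<open>finite T\<close> \<open>T \<noteq> {}\<close>] by (simp add: T_def)
    ultimately have "r \<in> T" by (simp add: T_def)
    with \<open>r < Min T\<close> Min_le[OF \<open>finite T\<close>, of r] show False by simp
  qed
  have inequivalent: "frag_of (Interior e0 t) - frag_of (Interior e0 t') \<notin> principal_divisors G len"
    if "t \<in> T" "t' \<in> T" "t < t'" for t t'
  proof
    assume "frag_of (Interior e0 t) - frag_of (Interior e0 t') \<in> principal_divisors G len"
    then have "of_int (C e0 * N) * (t' - t) \<in> \<int>"
      using equivalent_points_distance[of e0 C N t t'] C N(2) T that by blast
    then obtain k :: int where "of_int (C e0 * N) * (t' - t) = real_of_int k" by (rule Ints_cases)
    then have "real_of_int \<bar>k\<bar> = \<bar>of_int (C e0 * N) * (t' - t)\<bar>" by simp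
    also have "\<dots> = of_int (\<bar>C e0\<bar> * N) * (t' - t)"
      using N(1) that(3) by (simp add: abs_mult)
    finally have "real_of_int \<bar>k\<bar> = of_int (\<bar>C e0\<bar> * N) * (t' - t)" .
    moreover have "0 < real_of_int (\<bar>C e0\<bar> * N) * (t' - t)" using C(2) N(1) that(3) by simp
    moreover have "real_of_int (\<bar>C e0\<bar> * N) * (t' - t) < 1"
    proof -
      have "t' - t < 1 / of_int (\<bar>C e0\<bar> * N)" using that by (auto simp: T_def \<epsilon>_def)
      then show ?thesis using C(2) N(1) by (simp add: field_simps)
    qed
    ultimately have "0 < real_of_int \<bar>k\<bar>" "real_of_int \<bar>k\<bar> < 1" by linarith+
    then have "0 < \<bar>k\<bar>" "\<bar>k\<bar> < 1" by (simp_all only: of_int_0_less_iff of_int_less_1_iff)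
    then show False by linarith
  qed
  have "inj_on (\<lambda>t. abel_jacobi G len q (Interior e0 t)) T"
  proof (rule linorder_inj_onI)
    fix t t' assume "t < t'" "t \<in> T" "t' \<in> T"
    then show "abel_jacobi G len q (Interior e0 t) \<noteq> abel_jacobi G len q (Interior e0 t')"
      using inequivalent abel_jacobi_eq_imp_principal by blast
  qed auto
  moreover have "(\<lambda>t. abel_jacobi G len q (Interior e0 t)) ` T \<subseteq>
      abel_jacobi G len q ` points G len \<inter> torsion (Jac G len)"
  proof (rule image_subsetI)
    fix t assume t: "t \<in> T"
    obtain n where "0 < n" "frag_cmul (int n) (frag_of (Interior e0 t) - frag_of q) \<in> principal_divisors G len"
      using rational_point_torsion[OF C(1) assms(3) T(2-4)[OF t]] unfolding q_def by blast
    from abel_jacobi_in_torsion[OF q T(1)[OF t] this] T(1)[OF t]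
    show "abel_jacobi G len q (Interior e0 t) \<in> abel_jacobi G len q ` points G len \<inter> torsion (Jac G len)"
      by blast
  qed
  ultimately have "infinite (abel_jacobi G len q ` points G len \<inter> torsion (Jac G len))"
    using \<open>infinite T\<close> by (metis finite_imageD finite_subset)
  with q show ?thesis unfolding manin_mumford_def by blast
qed

end
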